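(* Let $k$ be a field of characteristic zero, let $d\in\mathbb N$, and let $N$ be a $d$-smallish $\mathrm{FS}_B^{\mathrm{op}}$-module over $k$. Then: (1) The generating function $H_B(N;t)=\sum_{n\ge 0} t^n\dim N[-n,n]$ is a rational function whose poles are contained in $\{1/j \mid 1\le j\le 2d+1\}$. (2) The limit $r_B^d(N):=\lim_{n\to\infty}\dim N[-n,n]/(2d+1)^n$ exists; equivalently, $H_B(N;t)$ has at worst a simple pole at $1/(2d+1)$, and $r_B^d(N)$ is the residue (in the sense of this limit). (3) If $\lambda,\mu$ are partitions with $|\lambda|+|\mu|=n$ and $\mathrm{Hom}_{W_n}(V_{\lambda,\mu},N[-n,n])\neq 0$, then $\ell(\lambda)\le d+1$ and $\ell(\mu)\le d$.
   Context: $\mathrm{FS}_B$ is the category whose objects are pairs $(E,\sigma)$ with $E$ a finite set and $\sigma:E\to E$ an involution with exactly one fixed point, and whose morphisms are surjective maps $\varphi$ with $\varphi\circ\sigma_1=\sigma_2\circ\varphi$. $[-n,n]$ denotes $\{-n,\dots,n\}$ with $k\mapsto -k$; every object is isomorphic to some $[-n,n]$, and $W_n=\mathrm{Aut}([-n,n])$ is the hyperoctahedral group (Coxeter group of type $B_n$, order $2^n n!$). An $\mathrm{FS}_B^{\mathrm{op}}$-module over $k$ is a contravariant functor from $\mathrm{FS}_B$ to $k$-vector spaces; $N[-n,n]:=N([-n,n])$, a $W_n$-representation. The principal projective $P_x$ sends $y$ to the $k$-vector space with basis $\mathrm{Hom}_{\mathrm{FS}_B}(y,x)$. A module is finitely generated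 in degree $\le d$ if it is a quotient of a finite direct sum of principal projectives $P_{[-m,m]}$ with $m\le d$ (i.e. generating objects having at most $d$ free $\sigma$-orbits). A module is $d$-small if it is isomorphic to a subquotient of a module finitely generated in degree $\le d$, and $d$-smallish if it admits a finite filtration whose associated graded module is $d$-small. For partitions $\lambda,\mu$ with $|\lambda|+|\mu|=n$, $V_{\lambda,\mu}$ is the irreducible $W_n$-representation over $k$ induced from $W_{|\lambda|}\times W_{|\mu|}$ by $(V_\lambda\otimes\text{(trivial character of }(\mathbb Z/2)^{|\lambda|}))\boxtimes (V_\mu\otimes\text{(sign character of }(\mathbb Z/2)^{|\mu|}))$, where $V_\lambda$ denotes the Specht module of $S_{|\lambda|}$; $\ell(\lambda)$ is the number of parts of $\lambda$. *)

theory Defs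
  imports Complex_Main "HOL-Library.Function_Algebras" "HOL-Library.Product_Plus"
    "HOL-Computational_Algebra.Polynomial_FPS" "HOL-Combinatorics.Permutations"
begin

text \<open>Objects: [-n,n] = {-n..n} with k |-> -k. A morphism [-n,n] -> [-m,m] is a surjective
map commuting with negation. It is represented by a function int => int which is
canonically extended by 0 outside [-n,n], so that equal maps are equal functions.\<close>

definition fsb_hom :: "nat \<Rightarrow> nat \<Rightarrow> (int \<Rightarrow> int) \<Rightarrow> bool" where
  "fsb_hom n m \<phi> \<longleftrightarrow>
     (\<forall>k. \<phi> (- k) = - \<phi> k) \<and>
     \<phi> ` {- int n .. int n} = {- int m .. int m} \<and>
     (\<forall>k. \<bar>k\<bar> > int n \<longrightarrow> \<phi> k = 0)"

definition fsb_id :: "nat \<Rightarrow> int \<Rightarrow> int" where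
  "fsb_id n = (\<lambda>k. if \<bar>k\<bar> \<le> int n then k else 0)"

definition fsb_inv :: "nat \<Rightarrow> (int \<Rightarrow> int) \<Rightarrow> int \<Rightarrow> int" where
  "fsb_inv n w = (\<lambda>k. if \<bar>k\<bar> \<le> int n then the_inv_into {- int n .. int n} w k else 0)"

text \<open>An FS_B^op-module over the field 'k: the value at [-n,n] is the subspace C n of an
ambient k-vector space (scale), and act n m phi : C m -> C n is the linear map N(phi) for
phi : [-n,n] -> [-m,m] (contravariant functoriality).\<close>

definition fsb_module ::
  "('k::field \<Rightarrow> 'v::ab_group_add \<Rightarrow> 'v) \<Rightarrow> (nat \<Rightarrow> 'v set) \<Rightarrow>
   (nat \<Rightarrow> nat \<Rightarrow> (int \<Rightarrow> int) \<Rightarrow> 'v \<Rightarrow> 'v) \<Rightarrow> bool" where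
  "fsb_module scale C act \<longleftrightarrow>
     vector_space scale \<and>
     (\<forall>n. module.subspace scale (C n)) \<and>
     (\<forall>n m \<phi>. fsb_hom n m \<phi> \<longrightarrow>
        act n m \<phi> ` C m \<subseteq> C n \<and>
        (\<forall>x\<in>C m. \<forall>y\<in>C m. act n m \<phi> (x + y) = act n m \<phi> x + act n m \<phi> y) \<and>
        (\<forall>c. \<forall>x\<in>C m. act n m \<phi> (scale c x) = scale c (act n m \<phi> x))) \<and>
     (\<forall>n. \<forall>x\<in>C n. act n n (fsb_id n) x = x) \<and>
     (\<forall>n m l \<phi> \<psi>. fsb_hom n m \<phi> \<longrightarrow> fsb_hom m l \<psi> \<longrightarrow>
        (\<forall>x\<in>C l. act n l (\<psi> \<circ> \<phi>) x = act n m \<phi> (act m l \<psi> x)))"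

definition fsb_submodule ::
  "('k::field \<Rightarrow> 'v::ab_group_add \<Rightarrow> 'v) \<Rightarrow> (nat \<Rightarrow> 'v set) \<Rightarrow>
   (nat \<Rightarrow> nat \<Rightarrow> (int \<Rightarrow> int) \<Rightarrow> 'v \<Rightarrow> 'v) \<Rightarrow> (nat \<Rightarrow> 'v set) \<Rightarrow> bool" where
  "fsb_submodule scale C act D \<longleftrightarrow>
     (\<forall>n. module.subspace scale (D n) \<and> D n \<subseteq> C n) \<and>
     (\<forall>n m \<phi>. fsb_hom n m \<phi> \<longrightarrow> act n m \<phi> ` D m \<subseteq> D n)"

text \<open>Natural isomorphism of subquotients B1/A1 = B2/A2 (of two modules), given by its graph
G, a submodule of B1 (+) B2 (Goursat).\<close>
definition sq_iso ::
  "('k::field \<Rightarrow> 'v::ab_group_add \<Rightarrow> 'v) \<Rightarrow> (nat \<Rightarrow> nat \<Rightarrow> (int \<Rightarrow> int) \<Rightarrow> 'v \<Rightarrow> 'v) \<Rightarrow>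
   (nat \<Rightarrow> 'v set) \<Rightarrow> (nat \<Rightarrow> 'v set) \<Rightarrow>
   ('k \<Rightarrow> 'w::ab_group_add \<Rightarrow> 'w) \<Rightarrow> (nat \<Rightarrow> nat \<Rightarrow> (int \<Rightarrow> int) \<Rightarrow> 'w \<Rightarrow> 'w) \<Rightarrow>
   (nat \<Rightarrow> 'w set) \<Rightarrow> (nat \<Rightarrow> 'w set) \<Rightarrow> bool" where
  "sq_iso scale1 act1 B1 A1 scale2 act2 B2 A2 \<longleftrightarrow>
     (\<exists>G. fsb_submodule (\<lambda>c p. (scale1 c (fst p), scale2 c (snd p)))
            (\<lambda>n. B1 n \<times> B2 n) (\<lambda>n m \<phi> p. (act1 n m \<phi> (fst p), act2 n m \<phi> (snd p))) G \<and>
          (\<forall>n. fst ` G n = B1 n \<and> snd ` G n = B2 n \<and>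
               {x. (x, 0) \<in> G n} = A1 n \<and> {y. (0, y) \<in> G n} = A2 n))"

text \<open>(+)_{i < length ms} P_{[-ms!i, ms!i]}: its value at [-n,n] has basis the pairs (i, phi)
with phi in Hom([-n,n],[-ms!i,ms!i]); elements are functions on such pairs.\<close>

definition pscale :: "'k::field \<Rightarrow> ((nat \<times> (int \<Rightarrow> int)) \<Rightarrow> 'k) \<Rightarrow> ((nat \<times> (int \<Rightarrow> int)) \<Rightarrow> 'k)" where
  "pscale c f = (\<lambda>x. c * f x)"

definition projsum_carrier :: "nat list \<Rightarrow> nat \<Rightarrow> ((nat \<times> (int \<Rightarrow> int)) \<Rightarrow> 'k::field) set" where
  "projsum_carrier ms n = {f. \<forall>i \<phi>. f (i, \<phi>) \<noteq> 0 \<longrightarrow> i < length ms \<and> fsb_hom n (ms ! i) \<phi>}"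

text \<open>For psi : [-n,n] -> [-m,m], P(psi) sends the basis vector phi to phi o psi.\<close>
definition projsum_act :: "nat list \<Rightarrow> nat \<Rightarrow> nat \<Rightarrow> (int \<Rightarrow> int) \<Rightarrow>
    ((nat \<times> (int \<Rightarrow> int)) \<Rightarrow> 'k::field) \<Rightarrow> ((nat \<times> (int \<Rightarrow> int)) \<Rightarrow> 'k)" where
  "projsum_act ms n m \<psi> f = (\<lambda>(i, \<chi>). \<Sum>\<phi> \<in> {\<phi>. fsb_hom m (ms ! i) \<phi> \<and> \<phi> \<circ> \<psi> = \<chi>}. f (i, \<phi>))"

text \<open>A subquotient B'/A' of a module is d-small if it is isomorphic to a subquotient B/A of
a module M finitely generated in degree <= d; M is written as ((+)_i P_{[-m_i,m_i]})/K with
all m_i <= d, and subquotients of M correspond to K <= A <= B.\<close>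
definition d_small_sq ::
  "nat \<Rightarrow> ('k::field \<Rightarrow> 'v::ab_group_add \<Rightarrow> 'v) \<Rightarrow> (nat \<Rightarrow> nat \<Rightarrow> (int \<Rightarrow> int) \<Rightarrow> 'v \<Rightarrow> 'v) \<Rightarrow>
   (nat \<Rightarrow> 'v set) \<Rightarrow> (nat \<Rightarrow> 'v set) \<Rightarrow> bool" where
  "d_small_sq d scale act B' A' \<longleftrightarrow>
     (\<exists>ms K A B. (\<forall>m\<in>set ms. m \<le> d) \<and>
        fsb_submodule pscale (projsum_carrier ms) (projsum_act ms) K \<and>
        fsb_submodule pscale (projsum_carrier ms) (projsum_act ms) A \<and>
        fsb_submodule pscale (projsum_carrier ms) (projsum_act ms) B \<and>
        (\<forall>n. K n \<subseteq> A n \<and> A n \<subseteq> B n) \<and>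
        sq_iso pscale (projsum_act ms) B A scale act B' A')"

definition d_small ::
  "nat \<Rightarrow> ('k::field \<Rightarrow> 'v::ab_group_add \<Rightarrow> 'v) \<Rightarrow> (nat \<Rightarrow> 'v set) \<Rightarrow>
   (nat \<Rightarrow> nat \<Rightarrow> (int \<Rightarrow> int) \<Rightarrow> 'v \<Rightarrow> 'v) \<Rightarrow> bool" where
  "d_small d scale C act \<longleftrightarrow> d_small_sq d scale act C (\<lambda>n. {0})"

text \<open>Filtration 0 = F 0 <= F 1 <= ... <= F r = N; the associated graded module
(+)_{i<r} F(i+1)/F i is realised as the subquotient (B'/A') of (+)_{i<r} N (functions nat => 'v)
with B' = (+) F(i+1), A' = (+) F i.\<close>
definition d_smallish ::
  "nat \<Rightarrow> ('k::field \<Rightarrow> 'v::ab_group_add \<Rightarrow> 'v) \<Rightarrow> (nat \<Rightarrow> 'v set) \<Rightarrow>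
   (nat \<Rightarrow> nat \<Rightarrow> (int \<Rightarrow> int) \<Rightarrow> 'v \<Rightarrow> 'v) \<Rightarrow> bool" where
  "d_smallish d scale C act \<longleftrightarrow>
     (\<exists>r F. (\<forall>i. fsb_submodule scale C act (F i)) \<and>
        F 0 = (\<lambda>n. {0}) \<and> F r = C \<and> (\<forall>i<r. \<forall>n. F i n \<subseteq> F (Suc i) n) \<and>
        d_small_sq d (\<lambda>c g i. scale c (g i)) (\<lambda>n m \<phi> g i. act n m \<phi> (g i))
          (\<lambda>n. {g. \<forall>i. (i < r \<longrightarrow> g i \<in> F (Suc i) n) \<and> (r \<le> i \<longrightarrow> g i = 0)})
          (\<lambda>n. {g. \<forall>i. (i < r \<longrightarrow> g i \<in> F i n) \<and> (r \<le> i \<longrightarrow> g i = 0)}))"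

definition fsb_dim :: "('k::field \<Rightarrow> 'v::ab_group_add \<Rightarrow> 'v) \<Rightarrow> (nat \<Rightarrow> 'v set) \<Rightarrow> nat \<Rightarrow> nat" where
  "fsb_dim scale C n = vector_space.dim scale (C n)"

definition hilb_B :: "('k::field \<Rightarrow> 'v::ab_group_add \<Rightarrow> 'v) \<Rightarrow> (nat \<Rightarrow> 'v set) \<Rightarrow> complex fps" where
  "hilb_B scale C = Abs_fps (\<lambda>n. of_nat (fsb_dim scale C n))"

definition is_partition :: "nat list \<Rightarrow> bool" where
  "is_partition la \<longleftrightarrow> (\<forall>x\<in>set la. 0 < x) \<and> sorted_wrt (\<ge>) la"

definition bicells :: "nat list \<Rightarrow> nat list \<Rightarrow> (bool \<times> nat \<times> nat) set" where
  "bicells la mu = {(True, i, j) | i j. i < length la \<and> j < la ! i} \<union>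
                   {(False, i, j) | i j. i < length mu \<and> j < mu ! i}"

definition bitableau :: "nat \<Rightarrow> nat list \<Rightarrow> nat list \<Rightarrow> ((bool \<times> nat \<times> nat) \<Rightarrow> nat) \<Rightarrow> bool" where
  "bitableau n la mu T \<longleftrightarrow> bij_betw T (bicells la mu) {1..n}"

definition bitabloid :: "nat \<Rightarrow> nat list \<Rightarrow> nat list \<Rightarrow> ((bool \<times> nat \<times> nat) \<Rightarrow> nat) \<Rightarrow>
    nat \<Rightarrow> (bool \<times> nat) option" where
  "bitabloid n la mu T l =
     (if l \<in> {1..n} then (let c = the_inv_into (bicells la mu) T l in Some (fst c, fst (snd c)))
      else None)"

definition col_perm :: "nat list \<Rightarrow> nat list \<Rightarrow> ((bool \<times> nat \<times> nat) \<Rightarrow> (bool \<times> nat \<times> nat)) \<Rightarrow> bool" where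
  "col_perm la mu \<sigma> \<longleftrightarrow> \<sigma> permutes bicells la mu \<and>
     (\<forall>c. fst (\<sigma> c) = fst c \<and> snd (snd (\<sigma> c)) = snd (snd c))"

definition bipolytabloid :: "nat \<Rightarrow> nat list \<Rightarrow> nat list \<Rightarrow> ((bool \<times> nat \<times> nat) \<Rightarrow> nat) \<Rightarrow>
    (nat \<Rightarrow> (bool \<times> nat) option) \<Rightarrow> 'k::field" where
  "bipolytabloid n la mu T = (\<lambda>r. \<Sum>\<sigma> \<in> {\<sigma>. col_perm la mu \<sigma> \<and> bitabloid n la mu (T \<circ> \<sigma>) = r}.
       of_int (sign \<sigma>))"

definition fscale :: "'k::field \<Rightarrow> ('a \<Rightarrow> 'k) \<Rightarrow> ('a \<Rightarrow> 'k)" where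
  "fscale c f = (\<lambda>x. c * f x)"

text \<open>V_{lambda,mu} realised inside the (sign-twisted) permutation module on bitabloids,
k[Omega] = Ind_{W_a x W_b}^{W_n}((M^lambda (x) triv) [x] (M^mu (x) sgn)), as the span of all
bi-polytabloids, i.e. Ind of (V_lambda (x) triv) [x] (V_mu (x) sgn).\<close>
definition V_B :: "nat list \<Rightarrow> nat list \<Rightarrow> ((nat \<Rightarrow> (bool \<times> nat) option) \<Rightarrow> 'k::field) set" where
  "V_B la mu = (let n = sum_list la + sum_list mu in
     module.span fscale {bipolytabloid n la mu T | T. bitableau n la mu T})"

text \<open>Signed permutation data of w in W_n: w(i) = eps_i * pi(i).\<close>
definition wperm :: "nat \<Rightarrow> (int \<Rightarrow> int) \<Rightarrow> nat \<Rightarrow> nat" where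
  "wperm n w i = (if i \<in> {1..n} then nat \<bar>w (int i)\<bar> else i)"

definition wsign :: "(int \<Rightarrow> int) \<Rightarrow> nat \<Rightarrow> 'k::field" where
  "wsign w i = (if w (int i) < 0 then - 1 else 1)"

text \<open>Left action of W_n on k[Omega]: w . delta_r = (prod_{i in mu-part of r} eps_i) delta_{r o pi^-1}.\<close>
definition bitab_act :: "nat \<Rightarrow> (int \<Rightarrow> int) \<Rightarrow> ((nat \<Rightarrow> (bool \<times> nat) option) \<Rightarrow> 'k::field) \<Rightarrow>
    ((nat \<Rightarrow> (bool \<times> nat) option) \<Rightarrow> 'k)" where
  "bitab_act n w f = (\<lambda>r.
     (\<Prod>i \<in> {i \<in> {1..n}. \<exists>j. r (wperm n w i) = Some (False, j)}. wsign w i) * f (r \<circ> wperm n w))"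

text \<open>Hom_{W_n}(V_{lambda,mu}, N[-n,n]) is nonzero; W_n = Aut([-n,n]) acts on the left on
N[-n,n] by w . x = N(w^-1) x.\<close>
definition hom_Wn_nonzero ::
  "('k::field \<Rightarrow> 'v::ab_group_add \<Rightarrow> 'v) \<Rightarrow> (nat \<Rightarrow> 'v set) \<Rightarrow>
   (nat \<Rightarrow> nat \<Rightarrow> (int \<Rightarrow> int) \<Rightarrow> 'v \<Rightarrow> 'v) \<Rightarrow> nat list \<Rightarrow> nat list \<Rightarrow> bool" where
  "hom_Wn_nonzero scale C act la mu \<longleftrightarrow>
     (let n = sum_list la + sum_list mu; V = (V_B la mu :: ((nat \<Rightarrow> (bool \<times> nat) option) \<Rightarrow> 'k) set) in
      \<exists>h. (\<forall>v\<in>V. h v \<in> C n) \<and>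
          (\<forall>x\<in>V. \<forall>y\<in>V. h (x + y) = h x + h y) \<and>
          (\<forall>c. \<forall>x\<in>V. h (fscale c x) = scale c (h x)) \<and>
          (\<forall>w. fsb_hom n n w \<longrightarrow> (\<forall>v\<in>V. h (bitab_act n w v) = act n n (fsb_inv n w) (h v))) \<and>
          (\<exists>v\<in>V. h v \<noteq> 0))"

end

theory Submission
  imports Defs "HOL-Library.List_Lexorder"
begin

text \<open>A map \<open>[-n, n] \<rightarrow> [-m, m]\<close> is a word of length \<open>n\<close> over the \<open>2 m + 1\<close> letters of \<open>[-m, m]\<close>, and
  a submodule of a sum of principal projectives has, degree by degree, the dimension of its set of
  leading words for a lexicographic order. Precomposition with the map that repeats the \<open>p\<close>-th
  letter at a later position \<open>q\<close> is monotone for this order, so the leading words form a language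
  \<open>L\<close> closed under inserting letters that have occurred before. By a variant of Higman's lemma
  such languages satisfy the ascending chain condition, and the identity
  \<open>H(L) = [\<epsilon> \<in> L] + t \<cdot> (\<Sum>a. H(a\<inverse>L))\<close> for the generating functions, in which \<open>a\<inverse>L \<supseteq> L\<close> for every
  letter \<open>a\<close> that has already occurred, yields rationality with denominators \<open>1 - j t\<close> by
  Noetherian induction. The factor for \<open>j = 2 m + 1\<close> occurs only when all \<open>a\<inverse>L\<close> equal \<open>L\<close>, that is
  for \<open>L = \<Sigma>\<^sup>*\<close> (or \<open>{}\<close>), hence at most once.

  For the last part, a polytabloid is negated by the signed transpositions within a column and by
  the sign changes of labels in \<open>\<mu>\<close>. If a first column is too long then, by the pigeonhole
  principle on \<open>\<bar>u(l)\<bar>\<close>, each basis vector \<open>u\<close> of each \<open>P\<^sub>m\<close>, \<open>m \<le> d\<close>, is fixed by one of these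
  reflections, so the corresponding antisymmetrizer kills all of them, and with them every
  subquotient.\<close>

section \<open>Languages closed under inserting earlier letters\<close>

text \<open>The minimal bad sequence construction of Nash-Williams: entries are fixed one at a time,
  each of least length among the bad continuations. Badness constrains only pairs of indices, so it
  passes to the limit.\<close>

lemma minimal_bad_sequence:
  fixes len :: "'b \<Rightarrow> nat" and bad :: "(nat \<Rightarrow> 'b) \<Rightarrow> bool"
  assumes bad_def: "\<And>f. bad f \<longleftrightarrow> (\<forall>i. f i \<in> A) \<and> (\<forall>i j. i < j \<longrightarrow> \<not> R (f i) (f j))"
    and "bad f"
  obtains m where "bad m"
    "\<And>n g. bad g \<Longrightarrow> (\<And>i. i < n \<Longrightarrow> g i = m i) \<Longrightarrow> len (m n) \<le> len (g n)"
proof -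
  have step: "\<exists>g. bad g \<and> (\<forall>i<n. g i = f i) \<and>
      (\<forall>h. bad h \<longrightarrow> (\<forall>i<n. h i = g i) \<longrightarrow> len (g n) \<le> len (h n))" if "bad f" for f n
    using ex_has_least_nat[of "\<lambda>g. bad g \<and> (\<forall>i<n. g i = f i)" f "\<lambda>g. len (g n)"] that by auto
  \<comment> \<open>\<open>G n\<close> is a bad sequence with minimal entry at \<open>n\<close>, and
    \<open>G (Suc n)\<close> keeps its entries up to \<open>n\<close>. The diagonal of
    \<open>G\<close> is the sequence sought.\<close>
  have "\<exists>G. \<forall>n. (bad (G n) \<and>
        (\<forall>h. bad h \<longrightarrow> (\<forall>i<n. h i = G n i) \<longrightarrow> len (G n n) \<le> len (h n))) \<and>
      (\<forall>i<Suc n. G (Suc n) i = G n i)"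
  proof (rule dependent_nat_choice, goal_cases)
    case 1
    then show ?case using step[OF \<open>bad f\<close>, of 0] by auto
  next
    case (2 g n)
    then show ?case using step[of g "Suc n"] by blast
  qed
  then obtain G where G: "\<And>n. bad (G n)"
      "\<And>n h. bad h \<Longrightarrow> (\<forall>i<n. h i = G n i) \<Longrightarrow> len (G n n) \<le> len (h n)"
      "\<And>n i. i < Suc n \<Longrightarrow> G (Suc n) i = G n i"
    by metis
  have stable: "G (i + k) i = G i i" for i k
    by (induction k) (auto simp: G(3))
  have stable: "G k i = G i i" if "i \<le> k" for i k
    using stable[of i "k - i"] that by simp
  show thesis
  proof
    show "bad (\<lambda>n. G n n)"
      unfolding bad_def
    proof (intro conjI allI impI)
      show "G i i \<in> A" for i
        using G(1)[of i] by (simp add: bad_def)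
      show "\<not> R (G i i) (G j j)" if "i < j" for i j
      proof -
        have "\<not> R (G j i) (G j j)" using G(1)[of j] that unfolding bad_def by iprover
        moreover have "G j i = G i i" using stable[of i j] that by simp
        ultimately show ?thesis by (rule back_subst[of "\<lambda>x. \<not> R x (G j j)"])
      qed
    qed
    show "len (G n n) \<le> len (g n)" if "bad g" "\<And>i. i < n \<Longrightarrow> g i = G i i" for n g
    proof -
      have "\<forall>i<n. g i = G n i"
      proof (intro allI impI)
        fix i assume "i < n"
        then show "g i = G n i" using that(2)[of i] stable[of i n] by simp
      qed
      then show ?thesis using G(2) that(1) by blast
    qed
  qed
qed

section \<open>The insertion order on words\<close>

text \<open>\<open>S\<close> is the stock of letters available for insertion. It grows with every
  matched letter, so from the stock \<open>{}\<close> only letters that occurred earlier can be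
  inserted.\<close>

inductive ins_le :: "'a set \<Rightarrow> 'a list \<Rightarrow> 'a list \<Rightarrow> bool" where
  Nil: "ins_le S [] []"
| keep: "ins_le (insert a S) u w \<Longrightarrow> ins_le S (a # u) (a # w)"
| add: "a \<in> S \<Longrightarrow> ins_le S u w \<Longrightarrow> ins_le S u (a # w)"

text \<open>Induction on the number of letters outside the stock, combined with a minimal bad
  sequence. Infinitely many of its terms share a first letter \<open>a\<close>, or one of its terms
  is repeated as the empty word. If \<open>a\<close> is new, the tails are compared with the larger
  stock; if \<open>a\<close> is in \<open>S\<close>, the tails yield a smaller bad sequence, as in
  Higman's lemma.\<close>

lemma ins_le_good:
  assumes "finite \<Sigma>" "S \<subseteq> \<Sigma>" "\<And>i :: nat. f i \<in> lists \<Sigma>"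
  shows "\<exists>i j. i < j \<and> ins_le S (f i) (f j)"
  using assms(2,3)
proof (induction "card (\<Sigma> - S)" arbitrary: S f rule: less_induct)
  case less
  define bad where
    "bad f \<longleftrightarrow> (\<forall>i. f i \<in> lists \<Sigma>) \<and> (\<forall>i j. i < j \<longrightarrow> \<not> ins_le S (f i) (f j))"
    for f :: "nat \<Rightarrow> 'a list"
  have "\<not> bad f"
  proof
    assume "bad f"
    then obtain m where m: "bad m"
      "\<And>n g. bad g \<Longrightarrow> (\<And>i. i < n \<Longrightarrow> g i = m i) \<Longrightarrow> length (m n) \<le> length (g n)"
      using minimal_bad_sequence[of bad "lists \<Sigma>" "ins_le S" f length] bad_def by blast
    have mS: "m i \<in> lists \<Sigma>" for i using m(1) by (simp add: bad_def)
    have mbad: "\<not> ins_le S (m i) (m j)" if "i < j" for i j using m(1) that by (simp add: bad_def)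
    \<comment> \<open>\<open>take 1\<close> has finitely many values and treats the empty word as
      one more class.\<close>
    have "finite ((\<lambda>i. take 1 (m i)) ` UNIV)"
    proof (rule finite_subset)
      show "(\<lambda>i. take 1 (m i)) ` UNIV \<subseteq> {w. set w \<subseteq> \<Sigma> \<and> length w \<le> 1}"
        using mS by (auto dest: in_set_takeD)
      show "finite {w. set w \<subseteq> \<Sigma> \<and> length w \<le> 1}"
        using finite_lists_length_le[OF assms(1)] .
    qed
    then obtain i0 where "infinite {i \<in> UNIV. take 1 (m i) = take 1 (m i0)}"
      using pigeonhole_infinite[of UNIV "\<lambda>i. take 1 (m i)"] by auto
    then obtain r :: "nat \<Rightarrow> nat" where r: "strict_mono r" "\<And>k. take 1 (m (r k)) = take 1 (m i0)"
      using infinite_enumerate by (smt (verit, best) mem_Collect_eq)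
    have rless: "r i < r j" if "i < j" for i j using r(1) that by (simp add: strict_mono_def)
    show False
    proof (cases "m i0")
      case Nil
      then have "m (r k) = []" for k using r(2)[of k] by (cases "m (r k)") auto
      then have "ins_le S (m (r 0)) (m (r 1))" by (simp add: ins_le.Nil)
      then show False using mbad[OF rless[of 0 1]] by simp
    next
      case (Cons a w0)
      have "\<exists>t. m (r k) = a # t" for k using r(2)[of k] Cons by (cases "m (r k)") auto
      then obtain t where t: "\<And>k. m (r k) = a # t k" by metis
      have a: "a \<in> \<Sigma>" and tS: "t k \<in> lists \<Sigma>" for k using mS[of "r k"] t[of k] by auto
      have not_keep: "\<not> ins_le (insert a S) (t i) (t j)" if "i < j" for i j
        using mbad[OF rless[OF that]] t ins_le.keep by metis
      show False
      proof (cases "a \<in> S")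
        case False
        then have "card (\<Sigma> - insert a S) < card (\<Sigma> - S)"
          using a assms(1) by (intro psubset_card_mono) auto
        then show False using less.hyps[of "insert a S" t] not_keep tS a less.prems(1) by blast
      next
        case True
        \<comment> \<open>The splice keeps the terms before position \<open>r 0\<close> and
          continues with the tails. A relation between a kept term and a tail would lift along
          \<open>ins_le.add\<close>, since \<open>a\<close> lies in \<open>S\<close>, to a relation
          within \<open>m\<close>.\<close>
        define g where "g i = (if i < r 0 then m i else t (i - r 0))" for i
        have "bad g"
          unfolding bad_def
        proof (intro conjI allI impI)
          show "g i \<in> lists \<Sigma>" for i using tS mS by (simp add: g_def)
          fix i j :: nat assume "i < j"
          consider "j < r 0" | "i < r 0" "r 0 \<le> j" | "r 0 \<le> i" using \<open>i < j\<close> by linarith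
          then show "\<not> ins_le S (g i) (g j)"
          proof cases
            case 1
            then show ?thesis using mbad \<open>i < j\<close> by (simp add: g_def)
          next
            case 2
            then have "i < r (j - r 0)"
              by (metis less_le_trans r(1) strict_mono_less_eq zero_le)
            then show ?thesis
              using mbad t ins_le.add[OF True] 2 unfolding g_def by (metis not_le)
          next
            case 3
            then show ?thesis
              using not_keep[of "i - r 0" "j - r 0"] True \<open>i < j\<close>
              by (simp add: g_def insert_absorb)
          qed
        qed
        then have "length (m (r 0)) \<le> length (g (r 0))"
          using m(2)[of g "r 0"] by (simp add: g_def)
        then show False using t[of 0] by (simp add: g_def)
      qed
    qed
  qed
  then show ?case using less.prems by (auto simp: bad_def)
qed

section \<open>The ascending chain condition for closed languages\<close>

text \<open>As in \<open>ins_le\<close>, \<open>S\<close> holds letters that may be inserted even at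
  the front. The parameter makes the class stable under left quotients: removing a first letter
  \<open>a\<close> puts \<open>a\<close> into the stock.\<close>

definition closed_lang :: "'a set \<Rightarrow> 'a list set \<Rightarrow> bool" where
  "closed_lang S L \<longleftrightarrow> (\<forall>u v a. u @ v \<in> L \<longrightarrow> a \<in> S \<union> set u \<longrightarrow> u @ a # v \<in> L)"

definition lquot :: "'a \<Rightarrow> 'a list set \<Rightarrow> 'a list set" where
  "lquot a L = {w. a # w \<in> L}"

lemma closed_langD: "closed_lang S L \<Longrightarrow> u @ v \<in> L \<Longrightarrow> a \<in> S \<union> set u \<Longrightarrow> u @ a # v \<in> L"
  by (erule closed_lang_def[THEN iffD1, rule_format])

lemma closed_lang_lquot:
  assumes "closed_lang S L"
  shows "closed_lang (insert a S) (lquot a L)"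
  unfolding closed_lang_def
proof (intro allI impI)
  fix u v b
  assume "u @ v \<in> lquot a L" "b \<in> insert a S \<union> set u"
  then have "(a # u) @ v \<in> L" "b \<in> S \<union> set (a # u)" by (auto simp: lquot_def)
  then show "u @ b # v \<in> lquot a L"
    using closed_langD[OF assms, of "a # u" v b] by (simp add: lquot_def)
qed

lemma closed_lang_subset_lquot: "closed_lang S L \<Longrightarrow> a \<in> S \<Longrightarrow> L \<subseteq> lquot a L"
  using closed_langD[of S L "[]"] by (auto simp: lquot_def)

lemma closed_lang_mono:
  assumes "closed_lang S L" "S' \<subseteq> S"
  shows "closed_lang S' L"
  unfolding closed_lang_def
proof (intro allI impI)
  fix u v a
  assume "u @ v \<in> L" "a \<in> S' \<union> set u"
  then show "u @ a # v \<in> L"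
    by (intro closed_langD[OF assms(1)]) (use assms(2) in blast)+
qed

text \<open>Closed languages are upward closed for \<open>ins_le\<close>. The rules
  \<open>keep\<close> and \<open>add\<close> peel off the first letter of \<open>w\<close>, which
  replaces the language by its quotient; hence \<open>L\<close> varies in the induction.\<close>

lemma ins_le_closed:
  "ins_le S u w \<Longrightarrow> closed_lang S L \<Longrightarrow> u \<in> L \<Longrightarrow> w \<in> L"
proof (induction arbitrary: L rule: ins_le.induct)
  case (keep a S u w)
  have "w \<in> lquot a L"
    using keep.prems by (intro keep.IH closed_lang_lquot) (simp_all add: lquot_def)
  then show ?case by (simp add: lquot_def)
next
  case (add a S u w)
  have "closed_lang S (lquot a L)"
    using closed_lang_lquot[OF add.prems(1), of a] by (rule closed_lang_mono) auto
  moreover have "u \<in> lquot a L"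
    using add.prems closed_lang_subset_lquot[OF add.prems(1) add.hyps(1)] by (rule_tac subsetD)
  ultimately have "w \<in> lquot a L" by (rule add.IH)
  then show ?case by (simp add: lquot_def)
qed assumption

text \<open>Given a new word \<open>w i\<close> at each stage of an infinite strict chain,
  \<open>ins_le_good\<close> yields \<open>i < j\<close> with \<open>w j\<close> above
  \<open>w i\<close>, so \<open>w j\<close> already lies in stage \<open>Suc i\<close>. The larger
  language comes first in the pair: well-founded induction may assume a claim for all strictly
  larger closed languages.\<close>

lemma wf_closed_lang:
  assumes "finite \<Sigma>" "S \<subseteq> \<Sigma>"
  shows "wf {(L', L). closed_lang S L' \<and> L' \<subseteq> lists \<Sigma> \<and> L \<subset> L'}"
  unfolding wf_iff_no_infinite_down_chain
proof
  assume "\<exists>f. \<forall>i. (f (Suc i), f i) \<in> {(L', L). closed_lang S L' \<and> L' \<subseteq> lists \<Sigma> \<and> L \<subset> L'}"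
  then obtain f where "\<forall>i. (f (Suc i), f i) \<in> {(L', L). closed_lang S L' \<and> L' \<subseteq> lists \<Sigma> \<and> L \<subset> L'}"
    by (rule exE)
  then have f: "closed_lang S (f (Suc i))" "f (Suc i) \<subseteq> lists \<Sigma>" "f i \<subset> f (Suc i)" for i
    unfolding mem_Collect_eq prod.case by iprover+
  then have "\<forall>i. \<exists>w. w \<in> f (Suc i) \<and> w \<notin> f i" by blast
  then obtain w where w: "\<And>i. w i \<in> f (Suc i)" "\<And>i. w i \<notin> f i" by metis
  have mono: "mono f" using f(3) by (simp add: mono_iff_le_Suc psubset_imp_subset)
  obtain i j where ij: "i < j" "ins_le S (w i) (w j)"
    using ins_le_good[OF assms, of w] w f(2) by blast
  have "w j \<in> f (Suc i)" using ins_le_closed[OF ij(2) f(1) w(1)] .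
  moreover have "f (Suc i) \<subseteq> f j" using mono ij(1) by (simp add: Suc_leI monoD)
  ultimately show False using w(2)[of j] by blast
qed

section \<open>Power series with poles at reciprocals of integers\<close>

unbundle fps_syntax

text \<open>The polynomial \<open>[:1, - of_nat j:]\<close> is 1 - j t. The factor for
  \<open>M\<close> appears once, the others to a common power \<open>e\<close>. Convergence is
  carried along with the denominator, so that the limit needs no partial fractions.\<close>

definition simple_at :: "nat \<Rightarrow> complex fps \<Rightarrow> bool" where
  "simple_at M f \<longleftrightarrow> convergent (\<lambda>n. f $ n / of_nat M ^ n) \<and>
     (\<exists>P e. fps_of_poly P =
        f * fps_of_poly ([:1, - of_nat M:] * (\<Prod>j\<in>{1..<M}. [:1, - of_nat j:]) ^ e))"

lemma fps_of_poly_linear_factor: "fps_of_poly [:1, - c:] = 1 - fps_const c * fps_X"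
  for c :: complex
  by (simp add: fps_of_poly_pCons fps_of_poly_const mult.commute fps_const_neg [symmetric]
      del: fps_const_neg)

lemma simple_at_scale:
  assumes "simple_at M f"
  shows "simple_at M (fps_const c * f)"
proof -
  obtain P e where 1: "fps_of_poly P =
      f * fps_of_poly ([:1, - of_nat M:] * (\<Prod>j\<in>{1..<M}. [:1, - of_nat j:]) ^ e)"
    using assms by (auto simp: simple_at_def)
  have "convergent (\<lambda>n. c * (f $ n / of_nat M ^ n))"
    using assms by (intro convergent_mult convergent_const) (simp add: simple_at_def)
  moreover have "fps_of_poly (smult c P) = fps_const c * f *
      fps_of_poly ([:1, - of_nat M:] * (\<Prod>j\<in>{1..<M}. [:1, - of_nat j:]) ^ e)"
    by (simp only: fps_of_poly_smult 1 mult.assoc)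
  ultimately show ?thesis unfolding simple_at_def by (auto simp del: fps_of_poly_mult)
qed

lemma simple_at_add:
  assumes "simple_at M f" "simple_at M g"
  shows "simple_at M (f + g)"
proof -
  define D :: "complex poly" where "D = (\<Prod>j\<in>{1..<M}. [:1, - of_nat j:])"
  obtain P e where 1: "fps_of_poly P = f * fps_of_poly ([:1, - of_nat M:] * D ^ e)"
    using assms(1) by (auto simp: simple_at_def D_def)
  obtain P' e' where 2: "fps_of_poly P' = g * fps_of_poly ([:1, - of_nat M:] * D ^ e')"
    using assms(2) by (auto simp: simple_at_def D_def)
  have "convergent (\<lambda>n. f $ n / of_nat M ^ n + g $ n / of_nat M ^ n)"
    using assms by (intro convergent_add) (simp_all add: simple_at_def)
  moreover have "fps_of_poly (P * D ^ e' + P' * D ^ e) =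
      (f + g) * fps_of_poly ([:1, - of_nat M:] * D ^ (e + e'))"
    unfolding fps_of_poly_add fps_of_poly_mult power_add 1[unfolded fps_of_poly_mult]
      2[unfolded fps_of_poly_mult]
    by (simp only: algebra_simps)
  ultimately show ?thesis unfolding simple_at_def D_def[symmetric]
    by (auto simp: add_divide_distrib simp del: fps_of_poly_mult)
qed

lemma simple_at_0: "simple_at M 0"
  unfolding simple_at_def
  by (auto intro!: convergent_const exI[of _ "0 :: complex poly"])

lemma simple_at_sum: "(\<And>i. i \<in> I \<Longrightarrow> simple_at M (f i)) \<Longrightarrow> simple_at M (sum f I)"
  by (induction I rule: infinite_finite_induct) (auto intro: simple_at_0 simple_at_add)

lemma simple_at_diff: "simple_at M f \<Longrightarrow> simple_at M g \<Longrightarrow> simple_at M (f - g)"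
  using simple_at_add[of M f "fps_const (- 1) * g"] simple_at_scale[of M g "-1"]
  by (metis diff_conv_add_uminus fps_const_1_eq_1 fps_const_neg mult_minus1)

lemma simple_at_fps_of_poly:
  assumes "M > 0"
  shows "simple_at M (fps_of_poly P)"
  unfolding simple_at_def
proof
  have "\<forall>\<^sub>F n in sequentially. fps_of_poly P $ n / of_nat M ^ n = 0"
    using eventually_gt_at_top[of "degree P"] by eventually_elim (simp add: coeff_eq_0)
  then have "(\<lambda>n. fps_of_poly P $ n / of_nat M ^ n) \<longlonglongrightarrow> 0"
    by (rule tendsto_eventually)
  then show "convergent (\<lambda>n. fps_of_poly P $ n / of_nat M ^ n)"
    by (rule convergentI)
qed (metis fps_of_poly_mult)

lemma simple_at_X_mult:
  assumes "simple_at M f" "M > 0"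
  shows "simple_at M (fps_X * f)"
proof -
  obtain P e where 1: "fps_of_poly P =
      f * fps_of_poly ([:1, - of_nat M:] * (\<Prod>j\<in>{1..<M}. [:1, - of_nat j:]) ^ e)"
    using assms by (auto simp: simple_at_def)
  have "convergent (\<lambda>n. inverse (of_nat M) * (f $ n / of_nat M ^ n))"
    using assms by (intro convergent_mult convergent_const) (auto simp add: simple_at_def)
  then have "convergent (\<lambda>n. (fps_X * f) $ Suc n / of_nat M ^ Suc n)"
    by (simp add: field_simps)
  then have "convergent (\<lambda>n. (fps_X * f) $ n / of_nat M ^ n)"
    using convergent_Suc_iff[of "\<lambda>n. (fps_X * f) $ n / of_nat M ^ n"] by simp
  moreover have "fps_of_poly (pCons 0 P) = fps_X * f *
      fps_of_poly ([:1, - of_nat M:] * (\<Prod>j\<in>{1..<M}. [:1, - of_nat j:]) ^ e)"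
    using 1 by (simp add: fps_of_poly_pCons mult_ac del: fps_of_poly_mult)
  ultimately show ?thesis unfolding simple_at_def by (auto simp del: fps_of_poly_mult)
qed

text \<open>The limit must be the fixed point \<open>l / (1 - q)\<close>, and the deviation from it
  contracts by \<open>q\<close> up to an error tending to 0. With \<open>q = j / M\<close> this
  controls division by 1 - j t for \<open>j < M\<close>.\<close>

lemma convergent_linear_recurrence:
  fixes a b :: "nat \<Rightarrow> complex"
  assumes "convergent a" "norm q < 1" "\<And>n. b (Suc n) = q * b n + a n"
  shows "convergent b"
proof -
  obtain l where l: "a \<longlonglongrightarrow> l" using assms(1) by (auto simp: convergent_def)
  define c where "c n = b n - l / (1 - q)" for n
  define \<epsilon> where "\<epsilon> n = norm (a n - l)" for n
  have "q \<noteq> 1" using assms(2) by auto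
  then have c_Suc: "c (Suc n) = q * c n + (a n - l)" for n
    by (simp add: c_def assms(3) field_simps)
  have "c \<longlonglongrightarrow> 0"
  proof (rule LIMSEQ_I)
    fix r :: real assume "r > 0"
    \<comment> \<open>Chosen so that \<open>norm q * (r / 2) + \<delta> = r / 2\<close>, which lets
      the bound below reproduce itself.\<close>
    define \<delta> where "\<delta> = r / 2 * (1 - norm q)"
    have "\<delta> > 0" using \<open>r > 0\<close> assms(2) by (simp add: \<delta>_def)
    then obtain N where N: "\<And>n. n \<ge> N \<Longrightarrow> norm (a n - l) < \<delta>"
      using LIMSEQ_D[OF l] by blast
    have bound: "norm (c (N + k)) \<le> norm q ^ k * norm (c N) + r / 2" for k
    proof (induction k)
      case 0
      then show ?case using \<open>r > 0\<close> by simp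
    next
      case (Suc k)
      have "norm (c (N + Suc k)) \<le> norm q * norm (c (N + k)) + \<delta>"
        using N[of "N + k"] norm_triangle_ineq[of "q * c (N + k)" "a (N + k) - l"]
        by (simp add: c_Suc norm_mult)
      also have "\<dots> \<le> norm q * (norm q ^ k * norm (c N) + r / 2) + \<delta>"
        using Suc by (simp add: mult_left_mono)
      also have "\<dots> = norm q ^ Suc k * norm (c N) + r / 2"
        by (simp add: \<delta>_def field_simps)
      finally show ?case .
    qed
    have "(\<lambda>k. norm q ^ k * norm (c N)) \<longlonglongrightarrow> 0 * norm (c N)"
      using assms(2) by (intro tendsto_mult LIMSEQ_power_zero tendsto_const) auto
    then obtain K where K: "\<And>k. k \<ge> K \<Longrightarrow> norm (norm q ^ k * norm (c N)) < r / 2"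
      using LIMSEQ_D[of "\<lambda>k. norm q ^ k * norm (c N)" 0 "r / 2"] \<open>r > 0\<close> by auto
    have "norm (c n) < r" if "n \<ge> N + K" for n
    proof -
      have "norm (norm q ^ (n - N) * norm (c N)) < r / 2" using that by (intro K) simp
      then have "norm q ^ (n - N) * norm (c N) < r / 2" by (simp add: abs_mult)
      then show ?thesis using bound[of "n - N"] that by simp
    qed
    then show "\<exists>no. \<forall>n\<ge>no. norm (c n - 0) < r" by auto
  qed
  then have "(\<lambda>n. c n + l / (1 - q)) \<longlonglongrightarrow> 0 + l / (1 - q)"
    by (intro tendsto_add tendsto_const)
  then show ?thesis by (auto simp: c_def convergent_def)
qed

lemma simple_at_divide_linear_factor:
  assumes "simple_at M (f * (1 - fps_const (of_nat j) * fps_X))" "j < M"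
  shows "simple_at M f"
proof (cases "j = 0")
  case True
  then show ?thesis using assms by simp
next
  case False
  define g where "g = f * (1 - fps_const (of_nat j) * fps_X)"
  define D :: "complex poly" where "D = (\<Prod>j\<in>{1..<M}. [:1, - of_nat j:])"
  obtain P e where 1: "fps_of_poly P = g * fps_of_poly ([:1, - of_nat M:] * D ^ e)"
    using assms(1) by (auto simp: simple_at_def D_def g_def)
  \<comment> \<open>\<open>D'\<close> is \<open>D\<close> without the factor for \<open>j\<close>:
    multiplying the numerator by \<open>D'\<close> completes the factor 1 - j t to a further power
    of \<open>D\<close>.\<close>
  define D' :: "complex poly" where "D' = (\<Prod>j\<in>{1..<M} - {j}. [:1, - of_nat j:])"
  have D: "D = [:1, - of_nat j:] * D'"
    unfolding D_def D'_def using False assms(2) by (subst prod.remove[of _ j]) auto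
  have "fps_of_poly (P * D') = f * fps_of_poly ([:1, - of_nat M:] * D ^ Suc e)"
    unfolding power_Suc D[THEN arg_cong, of "\<lambda>x. x * D ^ e"] fps_of_poly_mult 1
    by (simp add: g_def fps_of_poly_linear_factor mult_ac fps_of_poly_mult)
  moreover
  have g: "g $ Suc n = f $ Suc n - of_nat j * f $ n" for n
  proof -
    have "g = f - fps_const (of_nat j) * (fps_X * f)" by (simp add: g_def algebra_simps)
    then show ?thesis by simp
  qed
  have "convergent (\<lambda>n. g $ Suc n / of_nat M ^ Suc n)"
    using assms(1) convergent_Suc_iff[of "\<lambda>n. g $ n / of_nat M ^ n"]
    by (auto simp: simple_at_def g_def)
  then have "convergent (\<lambda>n. f $ n / of_nat M ^ n)"
  proof (rule convergent_linear_recurrence)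
    show "norm (of_nat j / of_nat M :: complex) < 1"
      using assms(2) by (simp add: norm_divide)
    show "f $ Suc n / of_nat M ^ Suc n =
        of_nat j / of_nat M * (f $ n / of_nat M ^ n) + g $ Suc n / of_nat M ^ Suc n" for n
      using assms(2) by (simp add: g field_simps)
  qed
  ultimately show ?thesis unfolding simple_at_def D_def[symmetric] by blast
qed

text \<open>With a constant numerator the factor 1 - M t itself is allowed: for \<open>j = M\<close>
  the coefficients are \<open>c * of_nat M ^ n\<close>, so the normalised sequence is
  constant.\<close>

lemma simple_at_geometric:
  assumes "f * (1 - fps_const (of_nat j) * fps_X) = fps_const c" "j \<le> M" "M > 0"
  shows "simple_at M f"
proof (cases "j = M")
  case False
  have "simple_at M (fps_of_poly [:c:])" by (rule simple_at_fps_of_poly) fact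
  then have "simple_at M (f * (1 - fps_const (of_nat j) * fps_X))"
    by (simp add: assms(1) fps_of_poly_const)
  then show ?thesis by (rule simple_at_divide_linear_factor) (use False assms(2) in simp)
next
  case True
  have eq: "f - fps_const (of_nat M) * (fps_X * f) = fps_const c"
    using assms(1) True by (simp add: algebra_simps)
  have "f $ n = c * of_nat M ^ n" for n
  proof (induction n)
    case 0
    then show ?case using arg_cong[OF eq, of "\<lambda>h. h $ 0"] by simp
  next
    case (Suc n)
    then show ?case using arg_cong[OF eq, of "\<lambda>h. h $ Suc n"] by simp
  qed
  then have "convergent (\<lambda>n. f $ n / of_nat M ^ n)"
    using assms(3) by (simp add: convergent_const)
  moreover have "fps_of_poly [:c:] = f * fps_of_poly ([:1, - of_nat M:] * D ^ 0)" for D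
    using assms(1) True by (simp add: fps_of_poly_linear_factor fps_of_poly_const)
  ultimately show ?thesis unfolding simple_at_def by blast
qed

section \<open>Generating functions of languages\<close>

definition lang_gf :: "'a list set \<Rightarrow> complex fps" where
  "lang_gf L = Abs_fps (\<lambda>n. of_nat (card {w \<in> L. length w = n}))"

lemma finite_words_of_length:
  "finite \<Sigma> \<Longrightarrow> L \<subseteq> lists \<Sigma> \<Longrightarrow> finite {w \<in> L. length w = n}"
  by (rule finite_subset[OF _ finite_lists_length_eq[of \<Sigma> n]]) auto

lemma lang_gf_lquot:
  assumes "finite \<Sigma>" "L \<subseteq> lists \<Sigma>"
  shows "lang_gf L = fps_const (of_bool ([] \<in> L)) + fps_X * (\<Sum>a\<in>\<Sigma>. lang_gf (lquot a L))"
proof (rule fps_ext)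
  fix n
  show "lang_gf L $ n =
      (fps_const (of_bool ([] \<in> L)) + fps_X * (\<Sum>a\<in>\<Sigma>. lang_gf (lquot a L))) $ n"
  proof (cases n)
    case 0
    have "{w \<in> L. length w = 0} = (if [] \<in> L then {[]} else {})" by auto
    then show ?thesis using 0 by (simp add: lang_gf_def)
  next
    case (Suc k)
    have fin: "finite {w \<in> lquot a L. length w = k}" if "a \<in> \<Sigma>" for a
      by (rule finite_words_of_length[OF assms(1)]) (use assms(2) in \<open>auto simp: lquot_def\<close>)
    have "{w \<in> L. length w = Suc k} = (\<Union>a\<in>\<Sigma>. (#) a ` {w \<in> lquot a L. length w = k})"
      using assms(2) by (fastforce simp: lquot_def length_Suc_conv)
    also have "card \<dots> = (\<Sum>a\<in>\<Sigma>. card ((#) a ` {w \<in> lquot a L. length w = k}))"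
      using assms(1) fin by (intro card_UN_disjoint) auto
    also have "\<dots> = (\<Sum>a\<in>\<Sigma>. card {w \<in> lquot a L. length w = k})"
      by (intro sum.cong refl card_image) auto
    finally show ?thesis by (simp add: Suc lang_gf_def fps_sum_nth)
  qed
qed

text \<open>The outer induction enlarges the stock \<open>S\<close>, the inner one the language.
  Letters with \<open>lquot a L = L\<close> contribute copies of \<open>lang_gf L\<close>, which
  move to the left-hand side and give the factor 1 - |T| t.\<close>

lemma simple_at_lang_gf:
  assumes "finite \<Sigma>" "card \<Sigma> \<le> M" "M > 0"
  shows "S \<subseteq> \<Sigma> \<Longrightarrow> closed_lang S L \<Longrightarrow> L \<subseteq> lists \<Sigma> \<Longrightarrow> simple_at M (lang_gf L)"
proof (induction "card (\<Sigma> - S)" arbitrary: S L rule: less_induct)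
  case (less S L)
  note outer = less.hyps and S = less.prems(1)
  show ?case
    using less.prems(2,3)
  proof (induction L rule: wf_induct_rule[OF wf_closed_lang[OF assms(1) S]])
    case (1 L)
    define T where "T = {a \<in> \<Sigma>. lquot a L = L}"
    have lists: "lquot a L \<subseteq> lists \<Sigma>" for a using 1(3) by (auto simp: lquot_def)
    have closed: "closed_lang (insert a S) (lquot a L)" for a
      by (rule closed_lang_lquot) fact
    \<comment> \<open>A quotient by a letter of the stock contains \<open>L\<close>, strictly
      because the letter is not in \<open>T\<close>; any other letter enlarges the stock.\<close>
    have rest: "simple_at M (lang_gf (lquot a L))" if a: "a \<in> \<Sigma> - T" for a
    proof (cases "a \<in> S")
      case True
      have "L \<subset> lquot a L"
        using closed_lang_subset_lquot[OF 1(2) True] a by (auto simp: T_def)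
      then show ?thesis using 1(1)[of "lquot a L"] closed[of a] lists True
        by (simp add: insert_absorb)
    next
      case False
      then have "card (\<Sigma> - insert a S) < card (\<Sigma> - S)"
        using a assms(1) by (intro psubset_card_mono) auto
      then show ?thesis using outer closed lists a S by blast
    qed
    have T: "T \<subseteq> \<Sigma>" by (auto simp: T_def)
    then have "finite T" using assms(1) finite_subset by blast
    have "(\<Sum>a\<in>\<Sigma>. lang_gf (lquot a L)) =
        (\<Sum>a\<in>T. lang_gf (lquot a L)) + (\<Sum>a\<in>\<Sigma> - T. lang_gf (lquot a L))"
      using T assms(1) by (metis add.commute sum.subset_diff)
    also have "(\<Sum>a\<in>T. lang_gf (lquot a L)) = fps_const (of_nat (card T)) * lang_gf L"
      by (simp add: T_def fps_of_nat)
    finally have split: "(\<Sum>a\<in>\<Sigma>. lang_gf (lquot a L)) =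
        fps_const (of_nat (card T)) * lang_gf L + (\<Sum>a\<in>\<Sigma> - T. lang_gf (lquot a L))" .
    have eq: "lang_gf L * (1 - fps_const (of_nat (card T)) * fps_X) =
        fps_const (of_bool ([] \<in> L)) + fps_X * (\<Sum>a\<in>\<Sigma> - T. lang_gf (lquot a L))"
      using lang_gf_lquot[OF assms(1) 1(3)] unfolding split by algebra
    \<comment> \<open>If every quotient equals \<open>L\<close>, the right-hand side is constant and
      |T| may equal \<open>M\<close>. Otherwise |T| < M, and dividing by the linear factor does not
      affect the pole at 1/M.\<close>
    show ?case
    proof (cases "T = \<Sigma>")
      case True
      then have "lang_gf L * (1 - fps_const (of_nat (card T)) * fps_X) =
        fps_const (of_bool ([] \<in> L))" using eq by simp
      then show ?thesis using True assms by (intro simple_at_geometric) auto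
    next
      case False
      then have "card T < M" using T assms by (meson order_less_le_trans psubsetI psubset_card_mono)
      moreover have "simple_at M (fps_of_poly [:of_bool ([] \<in> L):] +
          fps_X * (\<Sum>a\<in>\<Sigma> - T. lang_gf (lquot a L)))"
        using assms(3) rest
        by (intro simple_at_add simple_at_X_mult simple_at_sum simple_at_fps_of_poly) auto
      ultimately show ?thesis
        using simple_at_divide_linear_factor[of M "lang_gf L" "card T"]
        by (simp add: eq fps_of_poly_const)
    qed
  qed
qed

lemma simple_at_rational:
  assumes "simple_at M f" "M > 0"
  shows "\<exists>P Q :: complex poly. Q \<noteq> 0 \<and>
        (\<forall>z. poly Q z = 0 \<longrightarrow> z \<in> {1 / of_nat j | j. 1 \<le> j \<and> j \<le> M}) \<and>
        order (1 / of_nat M) Q \<le> 1 \<and> fps_of_poly P = f * fps_of_poly Q"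
proof -
  define D :: "complex poly" where "D = (\<Prod>j\<in>{1..<M}. [:1, - of_nat j:])"
  obtain P e where P: "fps_of_poly P = f * fps_of_poly ([:1, - of_nat M:] * D ^ e)"
    using assms(1) by (auto simp: simple_at_def D_def)
  define Q where "Q = [:1, - of_nat M:] * D ^ e"
  have root: "z = 1 / of_nat j" if "1 + z * - of_nat j = 0" for z :: complex and j :: nat
    using that by (cases "j = 0") (auto simp: field_simps)
  have rootsD: "\<exists>j\<in>{1..<M}. z = 1 / of_nat j" if "poly (D ^ e) z = 0" for z
    using that root by (fastforce simp: D_def poly_prod poly_power)
  \<comment> \<open>The roots of \<open>D ^ e\<close> are among the 1/j with j < M, so 1/M is a root
    of \<open>Q\<close> only through its first factor.\<close>
  have M_root: "poly (D ^ e) (1 / of_nat M) \<noteq> 0"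
  proof
    assume "poly (D ^ e) (1 / of_nat M) = 0"
    from rootsD[OF this] obtain j where "j < M" "1 / of_nat M = (1 / of_nat j :: complex)"
      by auto
    then show False by simp
  qed
  have "D \<noteq> 0" by (auto simp: D_def)
  then have "Q \<noteq> 0" by (simp add: Q_def del: mult_pCons_left)
  moreover have "z \<in> {1 / of_nat j | j. 1 \<le> j \<and> j \<le> M}" if "poly Q z = 0" for z
  proof (cases "poly (D ^ e) z = 0")
    case True
    then show ?thesis using rootsD[OF True] by force
  next
    case False
    then show ?thesis using that root[of z M] assms(2) by (force simp: Q_def)
  qed
  moreover have "order (1 / of_nat M) Q \<le> 1"
  proof -
    have "order (1 / of_nat M) Q = order (1 / of_nat M) [:1, - of_nat M :: complex:] +
        order (1 / of_nat M) (D ^ e)"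
      unfolding Q_def using \<open>Q \<noteq> 0\<close> by (intro order_mult) (simp add: Q_def)
    also have "order (1 / of_nat M) (D ^ e) = 0" using M_root order_root by blast
    also have "order (1 / of_nat M) [:1, - of_nat M :: complex:] \<le> 1"
      using order_degree[of "[:1, - of_nat M :: complex:]" "1 / of_nat M"] assms(2)
      by (simp split: if_splits)
    finally show ?thesis by simp
  qed
  ultimately show ?thesis using P unfolding Q_def by blast
qed


section \<open>Leading terms\<close>

definition is_lead :: "('x \<Rightarrow> 'o::linorder) \<Rightarrow> ('x \<Rightarrow> 'k::zero) \<Rightarrow> 'x \<Rightarrow> bool" where
  "is_lead key f x \<longleftrightarrow> f x \<noteq> 0 \<and> (\<forall>y. f y \<noteq> 0 \<longrightarrow> key y \<le> key x)"

definition leads :: "('x \<Rightarrow> 'o::linorder) \<Rightarrow> ('x \<Rightarrow> 'k::zero) set \<Rightarrow> 'x set" where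
  "leads key D = {x. \<exists>f\<in>D. is_lead key f x}"

lemma ex_is_lead:
  assumes "finite X" "\<And>v. f v \<noteq> 0 \<Longrightarrow> v \<in> X" "f u \<noteq> 0"
  shows "\<exists>z. is_lead key f z"
proof -
  have fin: "finite (key ` {v. f v \<noteq> 0})"
    by (intro finite_imageI finite_subset[OF _ assms(1)]) (use assms(2) in auto)
  have ne: "key ` {v. f v \<noteq> 0} \<noteq> {}" using assms(3) by auto
  obtain z where "f z \<noteq> 0" "key z = Max (key ` {v. f v \<noteq> 0})"
    using Max_in[OF fin ne] by auto
  then show ?thesis using Max_ge[OF fin] by (auto simp: is_lead_def)
qed

text \<open>Gaussian elimination along a linear relation: the quotient of the range of \<open>G\<close> by
  \<open>{y. (0, y) \<in> G}\<close> is isomorphic to the quotient of the domain of \<open>G\<close> by its kernel, and the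
  dimension of the latter is counted by pivots.\<close>

lemma (in vector_space) basis_linear_relation:
  fixes G :: "(('x \<Rightarrow> 'a) \<times> 'b) set" and key :: "'x \<Rightarrow> 'o::linorder"
  assumes X: "finite X" "inj_on key X"
    and supp: "\<And>x y v. (x, y) \<in> G \<Longrightarrow> x v \<noteq> 0 \<Longrightarrow> v \<in> X"
    and zero: "(\<lambda>v. 0, 0) \<in> G"
    and add: "\<And>x y x' y'. (x, y) \<in> G \<Longrightarrow> (x', y') \<in> G \<Longrightarrow> (\<lambda>v. x v + x' v, y + y') \<in> G"
    and scale: "\<And>c x y. (x, y) \<in> G \<Longrightarrow> (\<lambda>v. c * x v, scale c y) \<in> G"
    and b: "finite b" "independent b" "span b = {y. (\<lambda>v. 0, y) \<in> G}"
  shows "\<exists>b'. finite b' \<and> independent b' \<and> span b' = snd ` G \<and>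
    card b' = card b + card (leads key (fst ` G) - leads key {x. (x, 0) \<in> G})"
proof -
  \<comment> \<open>The pivots. Each contributes one new basis vector; a position that leads a
    kernel element contributes none, since it can be cleared without changing the second
    component.\<close>
  define Z where "Z = leads key (fst ` G) - leads key {x. (x, 0) \<in> G}"
  have "Z \<subseteq> X" using supp by (auto simp: Z_def leads_def is_lead_def)
  then have "finite Z" using X(1) finite_subset by blast
  have "\<forall>z\<in>Z. \<exists>x y. (x, y) \<in> G \<and> is_lead key x z" by (auto simp: Z_def leads_def)
  then obtain c y where cy: "\<And>z. z \<in> Z \<Longrightarrow> (c z, y z) \<in> G" "\<And>z. z \<in> Z \<Longrightarrow> is_lead key (c z) z"
    by metis
  have subG: "subspace (snd ` G)"
    unfolding subspace_def
  proof (intro conjI ballI allI)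
    show "0 \<in> snd ` G" using zero by force
    fix c y y'
    assume "y \<in> snd ` G"
    then obtain x where x: "(x, y) \<in> G" by auto
    show "scale c y \<in> snd ` G" using scale[OF x, of c] by (rule rev_image_eqI) simp
    assume "y' \<in> snd ` G"
    then obtain x' where "(x', y') \<in> G" by auto
    from add[OF x this] show "y + y' \<in> snd ` G" by (rule rev_image_eqI) simp
  qed
  \<comment> \<open>Pivots are added by increasing key, so that every vector spanned so far is
    related to some \<open>x\<close> supported strictly below the new pivot
    \<open>z\<close>.\<close>
  have "finite S \<Longrightarrow> S \<subseteq> Z \<Longrightarrow>
      independent (b \<union> y ` S) \<and> card (b \<union> y ` S) = card b + card S" for S
  proof (induction S rule: finite_ranking_induct[where f = key])
    case empty
    then show ?case using b by simp
  next
    case (insert z S)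
    show ?case
    proof (cases "z \<in> S")
      case True
      then show ?thesis using insert by (simp add: insert_absorb)
    next
      case False
      have S: "S \<subseteq> Z" and z: "z \<in> Z" using insert.prems by auto
      have less: "key s < key z" if "s \<in> S" for s
        using insert.hyps(2)[OF that] inj_onD[OF X(2), of s z] that S z \<open>Z \<subseteq> X\<close> False
        by force
      have small: "\<exists>x. (x, w) \<in> G \<and> (\<forall>v. x v \<noteq> 0 \<longrightarrow> key v < key z)"
        if "w \<in> span (b \<union> y ` S)" for w
        using that
      proof (induction rule: span_induct)
        case base
        show ?case
          unfolding subspace_def mem_Collect_eq
        proof (intro conjI ballI allI)
          show "\<exists>x. (x, 0) \<in> G \<and> (\<forall>v. x v \<noteq> 0 \<longrightarrow> key v < key z)"
            using zero by auto
        next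
          fix w w'
          assume "w \<in> {w. \<exists>x. (x, w) \<in> G \<and> (\<forall>v. x v \<noteq> 0 \<longrightarrow> key v < key z)}"
            and "w' \<in> {w. \<exists>x. (x, w) \<in> G \<and> (\<forall>v. x v \<noteq> 0 \<longrightarrow> key v < key z)}"
          then obtain x x' where "(x, w) \<in> G" "\<forall>v. x v \<noteq> 0 \<longrightarrow> key v < key z"
              "(x', w') \<in> G" "\<forall>v. x' v \<noteq> 0 \<longrightarrow> key v < key z"
            by auto
          then show "\<exists>x. (x, w + w') \<in> G \<and> (\<forall>v. x v \<noteq> 0 \<longrightarrow> key v < key z)"
            using add[of x w x' w'] by (intro exI[of _ "\<lambda>v. x v + x' v"]) force
        next
          fix a w
          assume "w \<in> {w. \<exists>x. (x, w) \<in> G \<and> (\<forall>v. x v \<noteq> 0 \<longrightarrow> key v < key z)}"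
          then obtain x where "(x, w) \<in> G" "\<forall>v. x v \<noteq> 0 \<longrightarrow> key v < key z" by auto
          then show "\<exists>x. (x, scale a w) \<in> G \<and> (\<forall>v. x v \<noteq> 0 \<longrightarrow> key v < key z)"
            using scale[of x w a] by (intro exI[of _ "\<lambda>v. a * x v"]) auto
        qed
      next
        case (step w)
        then consider "w \<in> b" | s where "s \<in> S" "w = y s" by auto
        then show ?case
        proof cases
          case 1
          then have "(\<lambda>v. 0, w) \<in> G" using span_base[of w b] b(3) by auto
          then show ?thesis by auto
        next
          case 2
          then show ?thesis
            using cy S less[of s] by (intro exI[of _ "c s"]) (force simp: is_lead_def)
        qed
      qed
      have "y z \<notin> span (b \<union> y ` S)"
      proof
        assume "y z \<in> span (b \<union> y ` S)"
        then obtain x where x: "(x, y z) \<in> G" "\<And>v. x v \<noteq> 0 \<Longrightarrow> key v < key z"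
          using small by blast
        \<comment> \<open>Subtracting the two relations for \<open>y z\<close> gives a kernel
          element that still leads at \<open>z\<close>, contrary to \<open>z\<close> being a
          pivot.\<close>
        have "(\<lambda>v. c z v + - 1 * x v, y z + scale (- 1) (y z)) \<in> G"
          by (intro add scale cy(1) x z)
        then have "(\<lambda>v. c z v - x v, 0) \<in> G" by simp
        moreover have "is_lead key (\<lambda>v. c z v - x v) z"
          unfolding is_lead_def
        proof (intro conjI allI impI)
          have "x z = 0" using x(2)[of z] by auto
          then show "c z z - x z \<noteq> 0" using cy(2)[OF z] by (simp add: is_lead_def)
          fix v assume "c z v - x v \<noteq> 0"
          then consider "c z v \<noteq> 0" | "x v \<noteq> 0" by (cases "c z v = 0") auto
          then show "key v \<le> key z"
            using cy(2)[OF z] x(2)[of v] by cases (auto simp: is_lead_def)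
        qed
        ultimately have "z \<in> leads key {x. (x, 0) \<in> G}" by (auto simp: leads_def)
        then show False using z by (simp add: Z_def)
      qed
      moreover from this have "y z \<notin> b \<union> y ` S"
        using span_superset[of "b \<union> y ` S"] by auto
      ultimately show ?thesis
        using insert.IH S insert.hyps(1) b(1) False by (auto simp: independent_insert)
    qed
  qed
  from this[OF \<open>finite Z\<close> subset_refl]
  have "independent (b \<union> y ` Z)" "card (b \<union> y ` Z) = card b + card Z" by auto
  \<comment> \<open>Spanning by reduction: the measure counts the positions up to the lead of
    \<open>x\<close>, and each step cancels that lead.\<close>
  moreover have "w \<in> span (b \<union> y ` Z)" if "(x, w) \<in> G" for x w
    using that
  proof (induction "card {v \<in> X. \<exists>u. x u \<noteq> 0 \<and> key v \<le> key u}" arbitrary: x w rule: less_induct)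
    case less
    show ?case
    proof (cases "x = (\<lambda>v. 0)")
      case True
      then have "w \<in> span b" using less.prems b(3) by simp
      then show ?thesis using span_mono[of b "b \<union> y ` Z"] by auto
    next
      case False
      then obtain u where "x u \<noteq> 0" by auto
      then obtain z where z: "is_lead key x z"
        using ex_is_lead[OF X(1)] supp[OF less.prems] by blast
      \<comment> \<open>The lead is cancelled either by a kernel element, with \<open>t = 0\<close>,
        or by the relation chosen for a pivot.\<close>
      have "\<exists>a t. (a, t) \<in> G \<and> is_lead key a z \<and> t \<in> span (b \<union> y ` Z)"
      proof (cases "z \<in> leads key {x. (x, 0) \<in> G}")
        case True
        then show ?thesis using span_zero by (auto simp: leads_def)
      next
        case False
        have "z \<in> leads key (fst ` G)" using z less.prems by (force simp: leads_def)
        then have "z \<in> Z" using False by (simp add: Z_def)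
        then show ?thesis using cy span_base[of "y z" "b \<union> y ` Z"] by blast
      qed
      then obtain a t where a: "(a, t) \<in> G" "is_lead key a z" "t \<in> span (b \<union> y ` Z)" by blast
      define q where "q = x z / a z"
      define x' where "x' = (\<lambda>v. x v + - q * a v)"
      have G': "(x', w + scale (- q) t) \<in> G"
        unfolding x'_def by (intro add scale less.prems a)
      have x'z: "x' z = 0" using a(2) by (simp add: x'_def q_def is_lead_def)
      have zX: "z \<in> X" using z supp[OF less.prems] by (auto simp: is_lead_def)
      have keyless: "key u < key z" if "x' u \<noteq> 0" for u
      proof -
        have "x u \<noteq> 0 \<or> a u \<noteq> 0" using that by (auto simp: x'_def)
        then have "key u \<le> key z" using z a(2) by (auto simp: is_lead_def)
        moreover have "u \<noteq> z" using that x'z by auto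
        ultimately show ?thesis
          using inj_onD[OF X(2), of u z] supp[OF G' that] zX by force
      qed
      have "{v \<in> X. \<exists>u. x' u \<noteq> 0 \<and> key v \<le> key u} \<subset> {v \<in> X. \<exists>u. x u \<noteq> 0 \<and> key v \<le> key u}"
      proof
        show "{v \<in> X. \<exists>u. x' u \<noteq> 0 \<and> key v \<le> key u} \<subseteq> {v \<in> X. \<exists>u. x u \<noteq> 0 \<and> key v \<le> key u}"
          using keyless z by (force simp: is_lead_def)
        have "z \<in> {v \<in> X. \<exists>u. x u \<noteq> 0 \<and> key v \<le> key u}" using zX z by (auto simp: is_lead_def)
        moreover have "z \<notin> {v \<in> X. \<exists>u. x' u \<noteq> 0 \<and> key v \<le> key u}" using keyless by force
        ultimately show "{v \<in> X. \<exists>u. x' u \<noteq> 0 \<and> key v \<le> key u} \<noteq>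
            {v \<in> X. \<exists>u. x u \<noteq> 0 \<and> key v \<le> key u}" by blast
      qed
      then have "card {v \<in> X. \<exists>u. x' u \<noteq> 0 \<and> key v \<le> key u} <
          card {v \<in> X. \<exists>u. x u \<noteq> 0 \<and> key v \<le> key u}"
        using X(1) by (intro psubset_card_mono) auto
      then have "w + scale (- q) t \<in> span (b \<union> y ` Z)" using less.hyps G' by blast
      then have "(w + scale (- q) t) - scale (- q) t \<in> span (b \<union> y ` Z)"
        using a(3) by (intro span_diff span_scale)
      then show ?thesis by simp
    qed
  qed
  moreover have "span (b \<union> y ` Z) \<subseteq> snd ` G"
  proof (rule span_minimal[OF _ subG])
    have "b \<subseteq> span b" using span_base by blast
    then show "b \<union> y ` Z \<subseteq> snd ` G" using b(3) cy(1) by force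
  qed
  ultimately have "independent (b \<union> y ` Z)" "card (b \<union> y ` Z) = card b + card Z"
    "span (b \<union> y ` Z) = snd ` G" by fastforce+
  then show ?thesis using b(1) \<open>finite Z\<close> unfolding Z_def[symmetric]
    by (intro exI[of _ "b \<union> y ` Z"]) simp
qed

section \<open>Leading words of submodules of sums of principal projectives\<close>

text \<open>The same letter at the same place cannot alter the first difference. In
  \<open>copy_letter_mono\<close> this treats the tails when the first letters agree and are the
  ones copied.\<close>

lemma insert_at_mono:
  fixes x y :: "'a::linorder list"
  assumes "x \<le> y" "length x = length y"
  shows "take q x @ a # drop q x \<le> take q y @ a # drop q y"
  using assms(2,1)
proof (induction x y arbitrary: q rule: list_induct2)
  case (Cons x xs y ys)
  then show ?case by (cases q) auto
qed simp

text \<open>Since \<open>p < q\<close>, the letter that decides a lexicographic comparison stays in front of any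
  disagreement that the copied letter introduces.\<close>

lemma copy_letter_mono:
  fixes x y :: "'a::linorder list"
  assumes "x \<le> y" "length x = length y" "p < q" "q \<le> length x"
  shows "take q x @ x ! p # drop q x \<le> take q y @ y ! p # drop q y"
  using assms(2,1,3,4)
proof (induction x y arbitrary: p q rule: list_induct2)
  case (Cons x xs y ys)
  then obtain q' where q: "q = Suc q'" by (cases q) auto
  show ?case
  proof (cases p)
    case 0
    then show ?thesis using Cons.prems Cons.hyps q insert_at_mono[of xs ys q' y] by auto
  next
    case (Suc p')
    then show ?thesis using Cons.prems Cons.IH[of p' q'] q by auto
  qed
qed simp

section \<open>Morphisms as words\<close>

text \<open>Oddness and the value 0 at 0 determine a morphism from its values on 1, ..., n.\<close>

definition fsb_word :: "nat \<Rightarrow> (int \<Rightarrow> int) \<Rightarrow> int list" where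
  "fsb_word n \<phi> = map \<phi> [1..int n]"

lemma length_fsb_word [simp]: "length (fsb_word n \<phi>) = n"
  by (simp add: fsb_word_def)

lemma nth_fsb_word: "i < n \<Longrightarrow> fsb_word n \<phi> ! i = \<phi> (int i + 1)"
  by (simp add: fsb_word_def add.commute)

lemma fsb_hom_abs_le: "fsb_hom n m \<phi> \<Longrightarrow> \<bar>\<phi> k\<bar> \<le> int m"
proof (cases "\<bar>k\<bar> \<le> int n")
  case True
  assume "fsb_hom n m \<phi>"
  moreover from True have "k \<in> {- int n..int n}" by auto
  ultimately have "\<phi> k \<in> {- int m..int m}" unfolding fsb_hom_def by blast
  then show ?thesis by auto
qed (simp add: fsb_hom_def)

lemma fsb_hom_zero: "fsb_hom n m \<phi> \<Longrightarrow> \<phi> 0 = 0"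
  unfolding fsb_hom_def by (metis add.inverse_neutral equal_neg_zero)

lemma fsb_word_inj:
  assumes "fsb_hom n m \<phi>" "fsb_hom n m' \<psi>" "fsb_word n \<phi> = fsb_word n \<psi>"
  shows "\<phi> = \<psi>"
proof
  have pos: "\<phi> k = \<psi> k" if "0 < k" "k \<le> int n" for k
  proof -
    have "fsb_word n \<phi> ! nat (k - 1) = fsb_word n \<psi> ! nat (k - 1)" using assms(3) by simp
    then show ?thesis using that by (simp add: nth_fsb_word nat_less_iff)
  qed
  fix k
  consider "0 < k" "k \<le> int n" | "0 < - k" "- k \<le> int n" | "k = 0" | "\<bar>k\<bar> > int n" by linarith
  then show "\<phi> k = \<psi> k"
  proof cases
    case 2
    then have "\<phi> (- k) = \<psi> (- k)" by (intro pos)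
    then show ?thesis using assms(1,2) by (simp add: fsb_hom_def)
  next
    case 3
    then show ?thesis using fsb_hom_zero assms(1,2) by metis
  next
    case 4
    then show ?thesis using assms(1,2) by (simp add: fsb_hom_def)
  qed (use pos in simp)
qed

lemma set_fsb_word: "fsb_hom n m \<phi> \<Longrightarrow> set (fsb_word n \<phi>) \<subseteq> {- int m..int m}"
  using fsb_hom_abs_le[of n m \<phi>] by (auto simp: fsb_word_def abs_le_iff minus_le_iff)

lemma finite_fsb_hom: "finite {\<phi>. fsb_hom n m \<phi>}"
proof (rule inj_on_finite)
  show "inj_on (fsb_word n) {\<phi>. fsb_hom n m \<phi>}" by (auto intro: inj_onI fsb_word_inj)
  show "fsb_word n ` {\<phi>. fsb_hom n m \<phi>} \<subseteq> {w. set w \<subseteq> {- int m..int m} \<and> length w = n}"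
    using set_fsb_word by auto
qed (simp add: finite_lists_length_eq)

lemma fsb_hom_comp:
  assumes "fsb_hom n m \<phi>" "fsb_hom m l \<psi>"
  shows "fsb_hom n l (\<psi> \<circ> \<phi>)"
proof -
  have "(\<psi> \<circ> \<phi>) ` {- int n..int n} = {- int l..int l}"
    unfolding image_comp[symmetric] using assms by (simp add: fsb_hom_def)
  then show ?thesis
    using assms fsb_hom_zero[OF assms(2)] by (simp add: fsb_hom_def)
qed

lemma fsb_submodule_act:
  "fsb_submodule scale C act D \<Longrightarrow> fsb_hom n m \<phi> \<Longrightarrow> x \<in> D m \<Longrightarrow> act n m \<phi> x \<in> D n"
  unfolding fsb_submodule_def by blast

text \<open>The odd extension of the map that fixes 1, ..., q, sends q + 1 to p + 1 and shifts
  larger arguments down by one. Word positions start at 0, so letter \<open>p\<close> is the value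
  at p + 1.\<close>

definition copy_map :: "nat \<Rightarrow> nat \<Rightarrow> nat \<Rightarrow> int \<Rightarrow> int" where
  "copy_map n p q k = (if \<bar>k\<bar> > int (Suc n) then 0 else sgn k *
     (if \<bar>k\<bar> \<le> int q then \<bar>k\<bar> else if \<bar>k\<bar> = int q + 1 then int p + 1 else \<bar>k\<bar> - 1))"

lemma fsb_hom_copy_map:
  assumes "p < q" "q \<le> n"
  shows "fsb_hom (Suc n) n (copy_map n p q)"
  unfolding fsb_hom_def
proof (intro conjI allI impI)
  show "copy_map n p q ` {- int (Suc n)..int (Suc n)} = {- int n..int n}"
  proof
    show "copy_map n p q ` {- int (Suc n)..int (Suc n)} \<subseteq> {- int n..int n}"
      using assms by (auto simp: copy_map_def sgn_if)
    show "{- int n..int n} \<subseteq> copy_map n p q ` {- int (Suc n)..int (Suc n)}"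
    proof
      fix k :: int
      assume k: "k \<in> {- int n..int n}"
      show "k \<in> copy_map n p q ` {- int (Suc n)..int (Suc n)}"
      proof (rule image_eqI)
        \<comment> \<open>Arguments beyond \<open>q\<close> have a preimage one step further from
          0.\<close>
        show "k = copy_map n p q (if \<bar>k\<bar> \<le> int q then k else k + sgn k)"
          using k assms by (auto simp: copy_map_def sgn_if)
      qed (use k in \<open>auto simp: sgn_if\<close>)
    qed
  qed
qed (auto simp: copy_map_def)

lemma fsb_word_copy_map:
  assumes "p < q" "q \<le> n"
  shows "fsb_word (Suc n) (\<phi> \<circ> copy_map n p q) =
    take q (fsb_word n \<phi>) @ fsb_word n \<phi> ! p # drop q (fsb_word n \<phi>)"
proof (rule nth_equalityI)
  fix i
  assume "i < length (fsb_word (Suc n) (\<phi> \<circ> copy_map n p q))"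
  then have i: "i < Suc n" by simp
  consider "i < q" | "i = q" | "q < i" by linarith
  then show "fsb_word (Suc n) (\<phi> \<circ> copy_map n p q) ! i =
      (take q (fsb_word n \<phi>) @ fsb_word n \<phi> ! p # drop q (fsb_word n \<phi>)) ! i"
  proof cases
    case 3
    then have "(fsb_word n \<phi> ! p # drop q (fsb_word n \<phi>)) ! (i - q) = \<phi> (int i)"
      using i assms by (simp add: nth_Cons' nth_fsb_word of_nat_diff)
    moreover have "copy_map n p q (int i + 1) = int i" using 3 i by (simp add: copy_map_def)
    ultimately show ?thesis using 3 i assms by (simp add: nth_fsb_word nth_append)
  qed (use i assms in \<open>auto simp: nth_fsb_word nth_append copy_map_def\<close>)
qed (use assms in simp)

section \<open>The languages of leading words\<close>

text \<open>The summand index comes first: different summands are compared by index alone, equal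
  ones by words. Encoded as one list of integers, the key inherits the lexicographic order.\<close>

definition fsb_key :: "nat \<Rightarrow> nat \<times> (int \<Rightarrow> int) \<Rightarrow> int list" where
  "fsb_key n x = int (fst x) # fsb_word n (snd x)"

definition projsum_basis :: "nat list \<Rightarrow> nat \<Rightarrow> (nat \<times> (int \<Rightarrow> int)) set" where
  "projsum_basis ms n = {(i, \<phi>). i < length ms \<and> fsb_hom n (ms ! i) \<phi>}"

lemma finite_projsum_basis: "finite (projsum_basis ms n)"
proof -
  have "projsum_basis ms n = (SIGMA i:{..<length ms}. {\<phi>. fsb_hom n (ms ! i) \<phi>})"
    by (auto simp: projsum_basis_def)
  then show ?thesis by (auto intro: finite_fsb_hom)
qed

lemma inj_on_fsb_key: "inj_on (fsb_key n) (projsum_basis ms n)"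
  by (auto simp: inj_on_def fsb_key_def projsum_basis_def intro: fsb_word_inj)

lemma projsum_carrier_support:
  "f \<in> projsum_carrier ms n \<Longrightarrow> f x \<noteq> 0 \<Longrightarrow> x \<in> projsum_basis ms n"
  by (cases x) (auto simp: projsum_carrier_def projsum_basis_def)

text \<open>The leading terms of all degrees form one language per summand; the length of a word
  recovers its degree.\<close>

definition lead_words :: "(nat \<Rightarrow> (nat \<times> (int \<Rightarrow> int) \<Rightarrow> 'k::zero) set) \<Rightarrow> nat \<Rightarrow> int list set" where
  "lead_words D i = {w. \<exists>n \<phi>. (i, \<phi>) \<in> leads (fsb_key n) (D n) \<and> w = fsb_word n \<phi>}"

lemma lead_words_mono: "(\<And>n. A n \<subseteq> B n) \<Longrightarrow> lead_words A i \<subseteq> lead_words B i"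
  unfolding lead_words_def leads_def by blast

lemma leads_subset_basis:
  "E \<subseteq> projsum_carrier ms n \<Longrightarrow> leads key E \<subseteq> projsum_basis ms n"
  using projsum_carrier_support by (fastforce simp: leads_def is_lead_def)

lemma card_leads:
  assumes "D n \<subseteq> projsum_carrier ms n"
  shows "card (leads (fsb_key n) (D n)) =
    (\<Sum>i<length ms. card {w \<in> lead_words D i. length w = n})"
proof -
  note basis = leads_subset_basis[OF assms]
  define E where "E i = {\<phi>. (i, \<phi>) \<in> leads (fsb_key n) (D n)}" for i
  have E: "E i \<subseteq> {\<phi>. fsb_hom n (ms ! i) \<phi>}" for i
    using basis by (auto simp: E_def projsum_basis_def)
  then have fin: "finite (E i)" for i using finite_fsb_hom finite_subset by blast
  have "leads (fsb_key n) (D n) = (SIGMA i:{..<length ms}. E i)"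
    using basis by (auto simp: E_def projsum_basis_def)
  then have "card (leads (fsb_key n) (D n)) = (\<Sum>i<length ms. card (E i))"
    using fin by (simp add: card_SigmaI)
  also have "\<dots> = (\<Sum>i<length ms. card {w \<in> lead_words D i. length w = n})"
  proof (intro sum.cong refl)
    fix i
    have "{w \<in> lead_words D i. length w = n} = fsb_word n ` E i"
      by (auto simp: lead_words_def E_def)
    moreover have "inj_on (fsb_word n) (E i)"
      using E[of i] by (auto intro!: inj_onI intro: fsb_word_inj)
    ultimately show "card (E i) = card {w \<in> lead_words D i. length w = n}"
      by (simp add: card_image)
  qed
  finally show ?thesis .
qed

lemma lead_words_lists:
  assumes "\<And>n. D n \<subseteq> projsum_carrier ms n"
  shows "lead_words D i \<subseteq> lists {- int (ms ! i)..int (ms ! i)}"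
proof
  fix w assume "w \<in> lead_words D i"
  then obtain n \<phi> where w: "(i, \<phi>) \<in> leads (fsb_key n) (D n)" "w = fsb_word n \<phi>"
    by (auto simp: lead_words_def)
  then have "fsb_hom n (ms ! i) \<phi>"
    using leads_subset_basis[OF assms[of n]] by (auto simp: projsum_basis_def)
  then show "w \<in> lists {- int (ms ! i)..int (ms ! i)}"
    using set_fsb_word w(2) by auto
qed

text \<open>Surjectivity of \<open>\<psi>\<close> makes it cancellable. Hence precomposition never
  merges two basis vectors, and \<open>projsum_act\<close> keeps their coefficients.\<close>

lemma fsb_hom_comp_cancel:
  assumes "fsb_hom n m \<psi>" "fsb_hom m l \<phi>" "fsb_hom m l' \<phi>'" "\<phi> \<circ> \<psi> = \<phi>' \<circ> \<psi>"
  shows "\<phi> = \<phi>'"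
proof
  fix k
  show "\<phi> k = \<phi>' k"
  proof (cases "\<bar>k\<bar> \<le> int m")
    case True
    then have "k \<in> \<psi> ` {- int n..int n}" using assms(1) by (auto simp: fsb_hom_def)
    then show ?thesis using assms(4) by (metis comp_apply imageE)
  qed (use assms(2,3) in \<open>simp add: fsb_hom_def\<close>)
qed

lemma projsum_act_comp:
  assumes "f \<in> projsum_carrier ms m" "fsb_hom n m \<psi>" "fsb_hom m (ms ! i) \<phi>"
  shows "projsum_act ms n m \<psi> f (i, \<phi> \<circ> \<psi>) = f (i, \<phi>)"
proof -
  have "{\<phi>'. fsb_hom m (ms ! i) \<phi>' \<and> \<phi>' \<circ> \<psi> = \<phi> \<circ> \<psi>} = {\<phi>}"
    using fsb_hom_comp_cancel[OF assms(2) _ assms(3)] assms(3) by auto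
  then show ?thesis by (simp add: projsum_act_def)
qed

lemma projsum_act_support:
  assumes "projsum_act ms n m \<psi> f (i, \<chi>) \<noteq> 0"
  obtains \<phi> where "fsb_hom m (ms ! i) \<phi>" "\<chi> = \<phi> \<circ> \<psi>" "f (i, \<phi>) \<noteq> 0"
  using assms unfolding projsum_act_def case_prod_conv
  by (elim sum.not_neutral_contains_not_neutral) auto

text \<open>If \<open>f\<close> leads at \<open>(i, \<phi>)\<close>, its image under the copy map
  \<open>\<psi>\<close> leads at \<open>(i, \<phi> \<circ> \<psi>)\<close>: the order is respected
  by \<open>copy_letter_mono\<close>, and the coefficient survives by
  \<open>projsum_act_comp\<close>.\<close>

lemma closed_lead_words:
  assumes "fsb_submodule pscale (projsum_carrier ms) (projsum_act ms) D"
  shows "closed_lang {} (lead_words D i)"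
  unfolding closed_lang_def
proof (intro allI impI)
  fix u v :: "int list" and a
  assume uv: "u @ v \<in> lead_words D i" and "a \<in> {} \<union> set u"
  then obtain p where p: "p < length u" "a = u ! p" by (auto simp: in_set_conv_nth)
  obtain n \<phi> f where f: "f \<in> D n" "is_lead (fsb_key n) f (i, \<phi>)" "u @ v = fsb_word n \<phi>"
    using uv by (auto simp: lead_words_def leads_def)
  define q where "q = length u"
  define \<psi> where "\<psi> = copy_map n p q"
  have "length (u @ v) = n" using f(3) by simp
  then have pq: "p < q" "q \<le> n" using p by (auto simp: q_def)
  have \<psi>: "fsb_hom (Suc n) n \<psi>" unfolding \<psi>_def using pq by (rule fsb_hom_copy_map)
  have carrier: "f \<in> projsum_carrier ms n" using assms f(1) by (auto simp: fsb_submodule_def)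
  have \<phi>: "fsb_hom n (ms ! i) \<phi>"
    using projsum_carrier_support[OF carrier, of "(i, \<phi>)"] f(2)
    by (auto simp: is_lead_def projsum_basis_def)
  define g where "g = projsum_act ms (Suc n) n \<psi> f"
  have gD: "g \<in> D (Suc n)"
    unfolding g_def using assms \<psi> f(1) by (rule fsb_submodule_act)
  have "is_lead (fsb_key (Suc n)) g (i, \<phi> \<circ> \<psi>)"
    unfolding is_lead_def
  proof (intro conjI allI impI)
    show "g (i, \<phi> \<circ> \<psi>) \<noteq> 0"
      using projsum_act_comp[OF carrier \<psi> \<phi>] f(2) by (simp add: g_def is_lead_def)
    fix x assume "g x \<noteq> 0"
    then obtain j \<phi>' where x: "x = (j, \<phi>' \<circ> \<psi>)" "f (j, \<phi>') \<noteq> 0"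
      unfolding g_def by (cases x) (metis projsum_act_support)
    then have "fsb_key n (j, \<phi>') \<le> fsb_key n (i, \<phi>)" using f(2) by (simp add: is_lead_def)
    then show "fsb_key (Suc n) x \<le> fsb_key (Suc n) (i, \<phi> \<circ> \<psi>)"
      using copy_letter_mono[of "fsb_word n \<phi>'" "fsb_word n \<phi>" p q] pq
      by (auto simp: fsb_key_def x(1) \<psi>_def fsb_word_copy_map)
  qed
  then have "fsb_word (Suc n) (\<phi> \<circ> \<psi>) \<in> lead_words D i"
    using gD by (auto simp: lead_words_def leads_def)
  moreover have "fsb_word (Suc n) (\<phi> \<circ> \<psi>) = u @ a # v"
    unfolding \<psi>_def fsb_word_copy_map[OF pq] f(3)[symmetric] using p by (simp add: q_def nth_append)
  ultimately show "u @ a # v \<in> lead_words D i" by simp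
qed

lemma simple_at_lead_words:
  assumes "fsb_submodule pscale (projsum_carrier ms) (projsum_act ms) D" "ms ! i \<le> d"
  shows "simple_at (2 * d + 1) (lang_gf (lead_words D i))"
proof (rule simple_at_lang_gf)
  show "lead_words D i \<subseteq> lists {- int (ms ! i)..int (ms ! i)}"
    using assms(1) by (intro lead_words_lists) (auto simp: fsb_submodule_def)
  show "closed_lang {} (lead_words D i)" using assms(1) by (rule closed_lead_words)
qed (use assms(2) in auto)

section \<open>Hilbert series of smallish modules\<close>

lemma module_pscale: "module (pscale :: 'k::field \<Rightarrow> (nat \<times> (int \<Rightarrow> int) \<Rightarrow> 'k) \<Rightarrow> _)"
  by standard (auto simp: pscale_def algebra_simps)

lemma module_pairs:
  "module s \<Longrightarrow> module t \<Longrightarrow> module (\<lambda>c p. (s c (fst p), t c (snd p)))"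
  unfolding module_def by (simp add: plus_prod_def)

lemma module_functions: "module s \<Longrightarrow> module (\<lambda>c g i. s c (g i))"
  unfolding module_def by (simp add: plus_fun_def fun_eq_iff)

text \<open>A homomorphism from a submodule of a sum of principal projectives to a quotient of \<open>act\<close>,
  as a linear relation.\<close>

definition fsb_relation where
  "fsb_relation ms scale act G \<longleftrightarrow>
     (\<forall>n x y. (x, y) \<in> G n \<longrightarrow> x \<in> projsum_carrier ms n) \<and>
     (\<forall>n. (0, 0) \<in> G n) \<and>
     (\<forall>n x y x' y'. (x, y) \<in> G n \<longrightarrow> (x', y') \<in> G n \<longrightarrow> (x + x', y + y') \<in> G n) \<and>
     (\<forall>n c x y. (x, y) \<in> G n \<longrightarrow> (pscale c x, scale c y) \<in> G n) \<and>
     (\<forall>n m \<phi> x y. fsb_hom n m \<phi> \<longrightarrow> (x, y) \<in> G m \<longrightarrow>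
        (projsum_act ms n m \<phi> x, act n m \<phi> y) \<in> G n)"

lemma fsb_relationD:
  assumes "fsb_relation ms scale act G"
  shows "(x, y) \<in> G n \<Longrightarrow> x \<in> projsum_carrier ms n"
    and "(0, 0) \<in> G n"
    and "(x, y) \<in> G n \<Longrightarrow> (x', y') \<in> G n \<Longrightarrow> (x + x', y + y') \<in> G n"
    and "(x, y) \<in> G n \<Longrightarrow> (pscale c x, scale c y) \<in> G n"
    and "fsb_hom n m \<phi> \<Longrightarrow> (x, y) \<in> G m \<Longrightarrow> (projsum_act ms n m \<phi> x, act n m \<phi> y) \<in> G n"
  using assms unfolding fsb_relation_def by blast+

lemma fsb_module_act_0:
  assumes "fsb_module scale C act" "fsb_hom n m \<phi>"
  shows "act n m \<phi> 0 = 0"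
proof -
  interpret vector_space scale using assms(1) by (simp add: fsb_module_def)
  have "0 \<in> C m" using assms(1) subspace_0 by (auto simp: fsb_module_def)
  then have "act n m \<phi> (0 + 0) = act n m \<phi> 0 + act n m \<phi> 0"
    using assms unfolding fsb_module_def by blast
  then show ?thesis by simp
qed

lemma fsb_submodule_fst:
  assumes "fsb_relation ms scale act G"
  shows "fsb_submodule pscale (projsum_carrier ms) (projsum_act ms) (\<lambda>n. fst ` G n)"
  unfolding fsb_submodule_def module.subspace_def[OF module_pscale]
proof (intro conjI allI impI ballI)
  note G = fsb_relationD[OF assms]
  show "0 \<in> fst ` G n" for n using G(2) by force
  show "fst ` G n \<subseteq> projsum_carrier ms n" for n using G(1) by auto
  show "projsum_act ms n m \<phi> ` fst ` G m \<subseteq> fst ` G n" if "fsb_hom n m \<phi>" for n m \<phi>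
    using G(5)[OF that] by force
  fix n c x x'
  assume "x \<in> fst ` G n"
  then obtain y where xy: "(x, y) \<in> G n" by auto
  show "pscale c x \<in> fst ` G n" using G(4)[OF xy, of c] by (rule rev_image_eqI) simp
  assume "x' \<in> fst ` G n"
  then obtain y' where "(x', y') \<in> G n" by auto
  from G(3)[OF xy this] show "x + x' \<in> fst ` G n" by (rule rev_image_eqI) simp
qed

lemma fsb_submodule_kernel:
  assumes "fsb_relation ms scale act G" "fsb_module scale C act"
  shows "fsb_submodule pscale (projsum_carrier ms) (projsum_act ms) (\<lambda>n. {x. (x, 0) \<in> G n})"
proof -
  interpret vector_space scale using assms(2) by (simp add: fsb_module_def)
  note G = fsb_relationD[OF assms(1)]
  show ?thesis
    unfolding fsb_submodule_def module.subspace_def[OF module_pscale]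
    using G(1,2) G(3)[of _ 0 _ _ 0] G(4)[of _ 0] G(5)[of _ _ _ _ 0] fsb_module_act_0[OF assms(2)]
    by auto
qed

text \<open>One basis vector is added for every pivot. Leads of the kernel are leads of the domain,
  so pivots are counted by subtraction, and the subtraction of naturals is exact in every
  summand.\<close>

lemma basis_fsb_relation:
  assumes "fsb_relation ms scale act G" "fsb_module scale C act"
    and "finite b" "\<not> module.dependent scale b" "module.span scale b = {y. (0, y) \<in> G n}"
  shows "\<exists>b'. finite b' \<and> \<not> module.dependent scale b' \<and> module.span scale b' = snd ` G n \<and>
    card b' = card b + (\<Sum>i<length ms.
      card {w \<in> lead_words (\<lambda>n. fst ` G n) i. length w = n} -
      card {w \<in> lead_words (\<lambda>n. {x. (x, 0) \<in> G n}) i. length w = n})"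
proof -
  interpret vector_space scale using assms(2) by (simp add: fsb_module_def)
  note G = fsb_relationD[OF assms(1)]
  let ?B = "\<lambda>n. fst ` G n" and ?A = "\<lambda>n. {x. (x, 0) \<in> G n}"
  have basis: "\<exists>b'. finite b' \<and> independent b' \<and> span b' = snd ` G n \<and>
    card b' = card b + card (leads (fsb_key n) (?B n) - leads (fsb_key n) (?A n))"
  proof (rule basis_linear_relation)
    show "finite (projsum_basis ms n)" by (rule finite_projsum_basis)
    show "inj_on (fsb_key n) (projsum_basis ms n)" by (rule inj_on_fsb_key)
    show "v \<in> projsum_basis ms n" if "(x, y) \<in> G n" "x v \<noteq> 0" for x y v
      using projsum_carrier_support[OF G(1)[OF that(1)] that(2)] .
    show "(\<lambda>v. 0, 0) \<in> G n" using G(2)[of n] by (simp add: zero_fun_def)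
    show "(\<lambda>v. x v + x' v, y + y') \<in> G n" if "(x, y) \<in> G n" "(x', y') \<in> G n" for x y x' y'
      using G(3)[OF that] by (simp add: plus_fun_def)
    show "(\<lambda>v. c * x v, scale c y) \<in> G n" if "(x, y) \<in> G n" for c x y
      using G(4)[OF that, of c] by (simp add: pscale_def)
    show "span b = {y. (\<lambda>v. 0, y) \<in> G n}" using assms(5) by (simp add: zero_fun_def)
  qed (use assms in auto)
  have AB: "?A k \<subseteq> ?B k" for k by force
  have "card (leads (fsb_key n) (?B n) - leads (fsb_key n) (?A n)) =
      card (leads (fsb_key n) (?B n)) - card (leads (fsb_key n) (?A n))"
  proof (rule card_Diff_subset)
    have A: "?A n \<subseteq> projsum_carrier ms n" using G(1) by auto
    show "finite (leads (fsb_key n) (?A n))"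
      using finite_subset[OF leads_subset_basis[OF A] finite_projsum_basis] .
    show "leads (fsb_key n) (?A n) \<subseteq> leads (fsb_key n) (?B n)"
      using AB unfolding leads_def by blast
  qed
  also have "\<dots> = (\<Sum>i<length ms. card {w \<in> lead_words ?B i. length w = n}) -
      (\<Sum>i<length ms. card {w \<in> lead_words ?A i. length w = n})"
    using G(1) by (subst (1 2) card_leads[of _ n ms]) auto
  also have "\<dots> = (\<Sum>i<length ms. card {w \<in> lead_words ?B i. length w = n} -
      card {w \<in> lead_words ?A i. length w = n})"
  proof (rule sum_subtractf_nat[symmetric])
    fix i
    have "?B k \<subseteq> projsum_carrier ms k" for k using G(1) by auto
    then have "finite {w \<in> lead_words ?B i. length w = n}"
      by (intro finite_words_of_length[OF _ lead_words_lists[of ?B ms]]) auto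
    then show "card {w \<in> lead_words ?A i. length w = n} \<le> card {w \<in> lead_words ?B i. length w = n}"
      using lead_words_mono[of ?A ?B i] AB by (intro card_mono) auto
  qed
  finally show ?thesis using basis by simp
qed

text \<open>Smallness of the associated graded module is one isomorphism for all layers at once.
  Restricting its graph to vectors concentrated in coordinate \<open>i\<close> gives a relation for
  the layer \<open>F (Suc i) / F i\<close>, with the same list \<open>ms\<close> for all
  \<open>i\<close>.\<close>

lemma d_smallish_filtration:
  fixes scale :: "'k::field \<Rightarrow> 'v::ab_group_add \<Rightarrow> 'v"
  assumes "fsb_module scale C act" "d_smallish d scale C act"
  obtains ms F r G where "\<forall>m\<in>set ms. m \<le> d" "F 0 = (\<lambda>n. {0})" "F r = C"
    "\<forall>i. fsb_submodule scale C act (F i)"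
    "\<forall>i<r. fsb_relation ms scale act (G i)"
    "\<forall>i<r. \<forall>n. snd ` G i n = F (Suc i) n"
    "\<forall>i<r. \<forall>n. {y. (0, y) \<in> G i n} = F i n"
proof -
  interpret vector_space scale using assms(1) by (simp add: fsb_module_def)
  obtain r F where F: "\<And>i. fsb_submodule scale C act (F i)" "F 0 = (\<lambda>n. {0})" "F r = C"
    "d_small_sq d (\<lambda>c g i. scale c (g i)) (\<lambda>n m \<phi> g i. act n m \<phi> (g i))
          (\<lambda>n. {g. \<forall>i. (i < r \<longrightarrow> g i \<in> F (Suc i) n) \<and> (r \<le> i \<longrightarrow> g i = 0)})
          (\<lambda>n. {g. \<forall>i. (i < r \<longrightarrow> g i \<in> F i n) \<and> (r \<le> i \<longrightarrow> g i = 0)})"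
    using assms(2) unfolding d_smallish_def by blast
  define B' where "B' n = {g. \<forall>i. (i < r \<longrightarrow> g i \<in> F (Suc i) n) \<and> (r \<le> i \<longrightarrow> g i = 0)}" for n
  define A' where "A' n = {g. \<forall>i. (i < r \<longrightarrow> g i \<in> F i n) \<and> (r \<le> i \<longrightarrow> g i = 0)}" for n
  obtain ms A B where ms: "\<And>m. m \<in> set ms \<Longrightarrow> m \<le> d"
    and B: "fsb_submodule pscale (projsum_carrier ms) (projsum_act ms) B"
    and sq: "sq_iso pscale (projsum_act ms) B A (\<lambda>c g i. scale c (g i))
      (\<lambda>n m \<phi> g i. act n m \<phi> (g i)) B' A'"
    using F(4) unfolding d_small_sq_def B'_def[abs_def, symmetric] A'_def[abs_def, symmetric] by blast
  obtain H where H: "fsb_submodule (\<lambda>c p. (pscale c (fst p), (\<lambda>i. scale c (snd p i))))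
            (\<lambda>n. B n \<times> B' n)
            (\<lambda>n m \<phi> p. (projsum_act ms n m \<phi> (fst p), (\<lambda>i. act n m \<phi> (snd p i)))) H"
      "\<And>n. snd ` H n = B' n" "\<And>n. {y. (0, y) \<in> H n} = A' n"
    using sq unfolding sq_iso_def by auto
  \<comment> \<open>The embedding as coordinate \<open>i\<close>. For \<open>i < r\<close> it pulls
    \<open>B'\<close> and \<open>A'\<close> back to \<open>F (Suc i)\<close> and
    \<open>F i\<close>.\<close>
  define \<iota> where "\<iota> i y = (\<lambda>j::nat. if j = i then y else (0::'v))" for i y
  define G where "G i n = {(x, y). (x, \<iota> i y) \<in> H n}" for i n
  have "module (\<lambda>c p. (pscale c (fst p), (\<lambda>i. scale c (snd p i))))"
    by (intro module_pairs[of pscale] module_pscale module_functions) (rule module_axioms)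
  note subspace = module.subspace_def[OF this]
  have H_add: "(x + x', g + g') \<in> H n" if "(x, g) \<in> H n" "(x', g') \<in> H n" for x g x' g' n
  proof -
    have "(x, g) + (x', g') \<in> H n"
      using H(1) that unfolding fsb_submodule_def subspace by blast
    then show ?thesis by simp
  qed
  have H_scale: "(pscale c x, \<lambda>i. scale c (g i)) \<in> H n" if "(x, g) \<in> H n" for x g c n
    using H(1) that unfolding fsb_submodule_def subspace by fastforce
  have H_0: "(0, 0) \<in> H n" for n
    using H(1) unfolding fsb_submodule_def subspace by (simp add: zero_prod_def)
  have H_act: "(projsum_act ms n m \<phi> x, \<lambda>i. act n m \<phi> (g i)) \<in> H n"
    if "fsb_hom n m \<phi>" "(x, g) \<in> H m" for n m \<phi> x g
    using fsb_submodule_act[OF H(1) that] by simp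
  have H_sub: "H n \<subseteq> B n \<times> B' n" for n
    using H(1) unfolding fsb_submodule_def by blast
  have zero_F: "0 \<in> F i n" for i n
    using F(1)[of i] subspace_0 unfolding fsb_submodule_def by blast
  have B'_\<iota>: "\<iota> i y \<in> B' n \<longleftrightarrow> y \<in> F (Suc i) n" and A'_\<iota>: "\<iota> i y \<in> A' n \<longleftrightarrow> y \<in> F i n"
    if "i < r" for i y n
    using that zero_F by (auto simp: B'_def A'_def \<iota>_def)
  have G: "fsb_relation ms scale act (G i)" "snd ` G i n = F (Suc i) n"
    "{y. (0, y) \<in> G i n} = F i n" if "i < r" for i n
  proof -
    show "fsb_relation ms scale act (G i)"
      unfolding fsb_relation_def
    proof (intro conjI allI impI)
      show "x \<in> projsum_carrier ms n" if "(x, y) \<in> G i n" for n x y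
        using that H_sub[of n] B unfolding fsb_submodule_def G_def by blast
      show "(0, 0) \<in> G i n" for n
        using H_0[of n] by (simp add: G_def \<iota>_def zero_fun_def)
      show "(x + x', y + y') \<in> G i n" if "(x, y) \<in> G i n" "(x', y') \<in> G i n" for n x y x' y'
      proof -
        have "\<iota> i y + \<iota> i y' = \<iota> i (y + y')" by (auto simp: \<iota>_def)
        then show ?thesis using that H_add[of x "\<iota> i y" n x' "\<iota> i y'"] by (simp add: G_def)
      qed
      show "(pscale c x, scale c y) \<in> G i n" if "(x, y) \<in> G i n" for n c x y
      proof -
        have "(\<lambda>j. scale c (\<iota> i y j)) = \<iota> i (scale c y)" by (auto simp: \<iota>_def)
        then show ?thesis using that H_scale[of x "\<iota> i y" n c] by (simp add: G_def)
      qed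
      show "(projsum_act ms n m \<phi> x, act n m \<phi> y) \<in> G i n"
        if "fsb_hom n m \<phi>" "(x, y) \<in> G i m" for n m \<phi> x y
      proof -
        have "(\<lambda>j. act n m \<phi> (\<iota> i y j)) = \<iota> i (act n m \<phi> y)"
          using fsb_module_act_0[OF assms(1) that(1)] by (auto simp: \<iota>_def)
        then show ?thesis using that H_act[of n m \<phi> x "\<iota> i y"] by (simp add: G_def)
      qed
    qed
    show "snd ` G i n = F (Suc i) n"
    proof
      show "snd ` G i n \<subseteq> F (Suc i) n"
        using H_sub[of n] B'_\<iota>[OF \<open>i < r\<close>] by (auto simp: G_def)
      show "F (Suc i) n \<subseteq> snd ` G i n"
      proof
        fix y assume "y \<in> F (Suc i) n"
        then have "\<iota> i y \<in> snd ` H n" using B'_\<iota>[OF \<open>i < r\<close>] H(2) by simp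
        then obtain x where "(x, \<iota> i y) \<in> H n" by auto
        then have "(x, y) \<in> G i n" by (simp add: G_def)
        then show "y \<in> snd ` G i n" by (rule rev_image_eqI) simp
      qed
    qed
    show "{y. (0, y) \<in> G i n} = F i n"
      using A'_\<iota>[OF \<open>i < r\<close>, of _ n] H(3)[of n] by (auto simp: G_def)
  qed
  show thesis by (rule that[of ms F r G]) (use ms F(1-3) G in blast)+
qed

lemma simple_at_hilb_B:
  fixes scale :: "'k::field \<Rightarrow> 'v::ab_group_add \<Rightarrow> 'v"
  assumes "fsb_module scale C act" "d_smallish d scale C act"
  shows "simple_at (2 * d + 1) (hilb_B scale C)"
proof -
  interpret vector_space scale using assms(1) by (simp add: fsb_module_def)
  obtain ms F r G where filtration: "\<forall>m\<in>set ms. m \<le> d" "F 0 = (\<lambda>n. {0})" "F r = C"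
      "\<forall>i. fsb_submodule scale C act (F i)"
      "\<forall>i<r. fsb_relation ms scale act (G i)"
      "\<forall>i<r. \<forall>n. snd ` G i n = F (Suc i) n"
      "\<forall>i<r. \<forall>n. {y. (0, y) \<in> G i n} = F i n"
    by (rule d_smallish_filtration[OF assms])
  note F = filtration(2,3) and ms = filtration(1)[rule_format]
    and G = filtration(5-7)[rule_format]
  define B where "B i = lead_words (\<lambda>n. fst ` G i n)" for i
  define A where "A i = lead_words (\<lambda>n. {x. (x, 0) \<in> G i n})" for i
  have AB: "A i j \<subseteq> B i j" for i j
    unfolding A_def B_def by (rule lead_words_mono) force
  \<comment> \<open>A finite basis is built up along the filtration instead of a dimension, which
    excludes the default value 0 of \<open>dim\<close> for infinite-dimensional spaces.\<close>
  have basis: "\<exists>b. finite b \<and> independent b \<and> span b = F k n \<and> card b =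
      (\<Sum>i<k. \<Sum>j<length ms. card {w \<in> B i j. length w = n} - card {w \<in> A i j. length w = n})"
    if "k \<le> r" for k n
    using that
  proof (induction k)
    case 0
    then show ?case by (intro exI[of _ "{}"]) (simp add: F(1) independent_empty)
  next
    case (Suc k)
    then obtain b where b: "finite b" "independent b" "span b = F k n" "card b =
        (\<Sum>i<k. \<Sum>j<length ms. card {w \<in> B i j. length w = n} - card {w \<in> A i j. length w = n})"
      by auto
    have k: "k < r" using Suc.prems by simp
    have "span b = {y. (0, y) \<in> G k n}" using b(3) G(3)[OF k] by simp
    from basis_fsb_relation[OF G(1)[OF k] assms(1) b(1,2) this]
    show ?case unfolding G(2)[OF k] by (auto simp: A_def B_def b(4))
  qed
  have fin: "finite {w \<in> B i j. length w = n}" if "i < r" for i j n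
    using fsb_relationD(1)[OF G(1)[OF that]] unfolding B_def
    by (intro finite_words_of_length[OF _ lead_words_lists[of _ ms]]) auto
  have "hilb_B scale C = (\<Sum>i<r. \<Sum>j<length ms. lang_gf (B i j) - lang_gf (A i j))"
  proof (rule fps_ext)
    fix n
    obtain b where b: "independent b" "span b = C n" "card b =
        (\<Sum>i<r. \<Sum>j<length ms. card {w \<in> B i j. length w = n} - card {w \<in> A i j. length w = n})"
      using basis[of r n] F(2) by auto
    have "fsb_dim scale C n = card b"
      unfolding fsb_dim_def b(2)[symmetric] using b(1) by (rule dim_span_eq_card_independent)
    moreover have "card {w \<in> A i j. length w = n} \<le> card {w \<in> B i j. length w = n}"
      if "i < r" for i j
      using AB[of i j] by (intro card_mono fin that) auto
    ultimately show "hilb_B scale C $ n =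
        (\<Sum>i<r. \<Sum>j<length ms. lang_gf (B i j) - lang_gf (A i j)) $ n"
      by (simp add: hilb_B_def lang_gf_def b(3) fps_sum_nth of_nat_diff)
  qed
  moreover have "simple_at (2 * d + 1) (\<Sum>i<r. \<Sum>j<length ms. lang_gf (B i j) - lang_gf (A i j))"
  proof (intro simple_at_sum simple_at_diff)
    fix i j
    assume "i \<in> {..<r}" "j \<in> {..<length ms}"
    then have "i < r" "ms ! j \<le> d" using ms by auto
    note rel = G(1)[OF this(1)]
    show "simple_at (2 * d + 1) (lang_gf (B i j))" "simple_at (2 * d + 1) (lang_gf (A i j))"
      unfolding A_def B_def
      using simple_at_lead_words[OF fsb_submodule_fst[OF rel] \<open>ms ! j \<le> d\<close>]
        simple_at_lead_words[OF fsb_submodule_kernel[OF rel assms(1)] \<open>ms ! j \<le> d\<close>] by blast+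
  qed
  ultimately show ?thesis by simp
qed

section \<open>Signed transpositions and polytabloids\<close>

lemma finite_bicells: "finite (bicells la mu)"
proof -
  have "bicells la mu \<subseteq> UNIV \<times> ({..<length la + length mu} \<times> {..<Max (set (0 # la @ mu)) + 1})"
    by (auto simp: bicells_def less_Suc_eq_le simp del: Max_insert intro!: order.trans[OF less_imp_le Max_ge])
  then show ?thesis by (rule finite_subset) auto
qed

text \<open>Trades the inverse of \<open>T\<close> for conditions read off cell by cell, through
  which relabellings are easily pushed.\<close>

lemma bitabloid_eq_iff:
  assumes "bij_betw T (bicells la mu) {1..n}"
  shows "bitabloid n la mu T = r \<longleftrightarrow>
    (\<forall>c\<in>bicells la mu. r (T c) = Some (fst c, fst (snd c))) \<and> (\<forall>l. l \<notin> {1..n} \<longrightarrow> r l = None)"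
proof -
  have inj: "inj_on T (bicells la mu)" and img: "T ` bicells la mu = {1..n}"
    using assms by (auto simp: bij_betw_def)
  have cell: "bitabloid n la mu T (T c) = Some (fst c, fst (snd c))" if "c \<in> bicells la mu" for c
    using the_inv_into_f_f[OF inj that] that img by (auto simp: bitabloid_def)
  show ?thesis
  proof safe
    assume *: "\<forall>c\<in>bicells la mu. r (T c) = Some (fst c, fst (snd c))"
      "\<forall>l. l \<notin> {1..n} \<longrightarrow> r l = None"
    show "bitabloid n la mu T = r"
    proof
      fix l
      show "bitabloid n la mu T l = r l"
      proof (cases "l \<in> {1..n}")
        case True
        then obtain c where "c \<in> bicells la mu" "l = T c" using img by blast
        then show ?thesis using cell * by simp
      next
        case False
        then have "bitabloid n la mu T l = None" unfolding bitabloid_def by (simp only: if_False)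
        then show ?thesis using *(2) False by simp
      qed
    qed
  qed (use cell in \<open>auto simp: bitabloid_def\<close>)
qed

lemma bij_betw_col_perm:
  assumes "bij_betw T (bicells la mu) {1..n}" "col_perm la mu \<sigma>"
  shows "bij_betw (T \<circ> \<sigma>) (bicells la mu) {1..n}"
  using assms by (auto simp: col_perm_def intro: bij_betw_trans permutes_imp_bij)

text \<open>Column permutations never move a cell from one diagram to the other. This decides which
  labels contribute to the sign in \<open>bitab_act\<close>.\<close>

lemma bipolytabloid_support:
  assumes "bij_betw T (bicells la mu) {1..n}" "bipolytabloid n la mu T r \<noteq> (0 :: 'k::field)"
    "a \<in> bicells la mu"
  shows "\<exists>j. r (T a) = Some (fst a, j)"
proof -
  have "{\<sigma>. col_perm la mu \<sigma> \<and> bitabloid n la mu (T \<circ> \<sigma>) = r} \<noteq> {}"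
    using assms(2) unfolding bipolytabloid_def by (metis sum.empty)
  then obtain \<sigma> where \<sigma>: "col_perm la mu \<sigma>" "bitabloid n la mu (T \<circ> \<sigma>) = r" by auto
  then have perm: "\<sigma> permutes bicells la mu" by (simp add: col_perm_def)
  then obtain c where c: "c \<in> bicells la mu" "\<sigma> c = a"
    using assms(3) permutes_image[OF perm] by (metis imageE)
  have "r ((T \<circ> \<sigma>) c) = Some (fst c, fst (snd c))"
    using bitabloid_eq_iff[OF bij_betw_col_perm[OF assms(1) \<sigma>(1)], THEN iffD1, OF \<sigma>(2)] c(1)
    by (rule_tac bspec) (rule conjunct1)
  then have "r (T a) = Some (fst c, fst (snd c))" using c(2) by simp
  moreover have "fst c = fst a" using \<sigma>(1) c(2) unfolding col_perm_def by metis
  ultimately show ?thesis by simp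
qed

text \<open>Swapping the labels of two cells of one column amounts to composing the column
  permutations with \<open>\<tau>\<close>, which reindexes the sum and flips every sign.\<close>

lemma bipolytabloid_transpose:
  assumes T: "bij_betw T (bicells la mu) {1..n}"
    and ab: "a \<in> bicells la mu" "b \<in> bicells la mu" "a \<noteq> b" "fst a = fst b" "snd (snd a) = snd (snd b)"
  shows "bipolytabloid n la mu T (r \<circ> transpose (T a) (T b)) = - (bipolytabloid n la mu T r :: 'k::field)"
proof -
  define \<tau> where "\<tau> = transpose a b"
  define \<pi> where "\<pi> = transpose (T a) (T b)"
  have \<tau>: "\<tau> permutes bicells la mu" unfolding \<tau>_def using ab by (intro permutes_swap_id)
  have inj: "inj_on T (bicells la mu)" and img: "T ` bicells la mu = {1..n}"
    using T by (auto simp: bij_betw_def)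
  have T\<tau>: "T (\<tau> c) = \<pi> (T c)" if "c \<in> bicells la mu" for c
    using that inj_on_eq_iff[OF inj, of c a] inj_on_eq_iff[OF inj, of c b] ab
    by (auto simp: \<tau>_def \<pi>_def transpose_def)
  have \<tau>_col: "fst (\<tau> c) = fst c" "snd (snd (\<tau> c)) = snd (snd c)" for c
    by (simp_all add: \<tau>_def transpose_def ab(4,5))
  have col: "col_perm la mu (\<tau> \<circ> \<sigma>)" if "col_perm la mu \<sigma>" for \<sigma>
    using that permutes_compose[OF _ \<tau>] by (simp add: col_perm_def \<tau>_col)
  have \<pi>_out: "\<pi> l = l" if "l \<notin> {1..n}" for l
    using that ab img by (auto simp: \<pi>_def transpose_def)
  have tabloid: "bitabloid n la mu (T \<circ> (\<tau> \<circ> \<sigma>)) = r \<longleftrightarrow> bitabloid n la mu (T \<circ> \<sigma>) = r \<circ> \<pi>"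
    if \<sigma>: "col_perm la mu \<sigma>" for \<sigma>
  proof -
    have "\<sigma> c \<in> bicells la mu" if "c \<in> bicells la mu" for c
    proof -
      have "\<sigma> permutes bicells la mu" using \<sigma> by (simp add: col_perm_def)
      then show ?thesis using that by (simp add: permutes_in_image)
    qed
    then show ?thesis
      using bitabloid_eq_iff[OF bij_betw_col_perm[OF T \<sigma>], of "r \<circ> \<pi>"]
        bitabloid_eq_iff[OF bij_betw_col_perm[OF T col[OF \<sigma>]], of r]
      by (simp add: T\<tau> \<pi>_out)
  qed
  have \<tau>\<tau>: "\<tau> \<circ> (\<tau> \<circ> \<sigma>) = \<sigma>" for \<sigma> by (simp add: \<tau>_def fun_eq_iff)
  have sign: "sign (\<tau> \<circ> \<sigma>) = - sign \<sigma>" if "col_perm la mu \<sigma>" for \<sigma>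
  proof -
    have "permutation \<sigma>" "permutation \<tau>"
      using that \<tau> finite_bicells permutation_permutes unfolding col_perm_def by blast+
    then show ?thesis using ab(3) by (simp add: sign_compose \<tau>_def sign_swap_id)
  qed
  have "bipolytabloid n la mu T (r \<circ> \<pi>) = (\<Sum>\<sigma> \<in> {\<sigma>. col_perm la mu \<sigma> \<and>
      bitabloid n la mu (T \<circ> \<sigma>) = r}. - of_int (sign \<sigma>) :: 'k)"
    unfolding bipolytabloid_def
  proof (rule sum.reindex_bij_witness[where i = "\<lambda>\<sigma>. \<tau> \<circ> \<sigma>" and j = "\<lambda>\<sigma>. \<tau> \<circ> \<sigma>"])
    fix \<sigma>
    assume "\<sigma> \<in> {\<sigma>. col_perm la mu \<sigma> \<and> bitabloid n la mu (T \<circ> \<sigma>) = r \<circ> \<pi>}"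
    then show "\<tau> \<circ> \<sigma> \<in> {\<sigma>. col_perm la mu \<sigma> \<and> bitabloid n la mu (T \<circ> \<sigma>) = r}"
        "- of_int (sign (\<tau> \<circ> \<sigma>)) = (of_int (sign \<sigma>) :: 'k)"
      using tabloid[of \<sigma>] by (simp_all add: col sign)
  next
    fix \<sigma>
    assume "\<sigma> \<in> {\<sigma>. col_perm la mu \<sigma> \<and> bitabloid n la mu (T \<circ> \<sigma>) = r}"
    then show "\<tau> \<circ> \<sigma> \<in> {\<sigma>. col_perm la mu \<sigma> \<and> bitabloid n la mu (T \<circ> \<sigma>) = r \<circ> \<pi>}"
      using tabloid[OF col, of \<sigma>, unfolded \<tau>\<tau>] by (simp add: col)
  qed (rule \<tau>\<tau>)+
  then show ?thesis by (simp add: bipolytabloid_def sum_negf \<pi>_def)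
qed

text \<open>The reflection \<open>p \<mapsto> \<epsilon> q, q \<mapsto> \<epsilon> p\<close>; for \<open>p = q\<close> and \<open>\<epsilon> = - 1\<close> it negates \<open>p\<close>.\<close>

definition signed_transposition :: "nat \<Rightarrow> nat \<Rightarrow> nat \<Rightarrow> int \<Rightarrow> int \<Rightarrow> int" where
  "signed_transposition n p q \<epsilon> k = (if \<bar>k\<bar> > int n then 0 else if \<bar>k\<bar> = int p then \<epsilon> * sgn k * int q
     else if \<bar>k\<bar> = int q then \<epsilon> * sgn k * int p else k)"

section \<open>Basic properties of the reflections\<close>

context
  fixes n p q :: nat and \<epsilon> :: int
  assumes pq: "p \<in> {1..n}" "q \<in> {1..n}" and \<epsilon>: "\<epsilon> = 1 \<or> \<epsilon> = - 1"
begin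

lemma signed_transposition_invol:
  "signed_transposition n p q \<epsilon> (signed_transposition n p q \<epsilon> k) = fsb_id n k"
proof -
  consider "\<bar>k\<bar> > int n" | "k = int p" | "k = - int p" | "k = int q" | "k = - int q"
    | "\<bar>k\<bar> \<le> int n" "\<bar>k\<bar> \<noteq> int p" "\<bar>k\<bar> \<noteq> int q" by linarith
  then show ?thesis
    using pq \<epsilon> by cases (auto simp: signed_transposition_def fsb_id_def)
qed

lemma fsb_hom_signed_transposition: "fsb_hom n n (signed_transposition n p q \<epsilon>)"
  unfolding fsb_hom_def
proof (intro conjI allI impI)
  let ?w = "signed_transposition n p q \<epsilon>"
  have sub: "?w ` {- int n..int n} \<subseteq> {- int n..int n}"
    using pq \<epsilon> by (auto simp: signed_transposition_def sgn_if)
  show "?w ` {- int n..int n} = {- int n..int n}"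
  proof
    show "{- int n..int n} \<subseteq> ?w ` {- int n..int n}"
    proof
      fix k assume k: "k \<in> {- int n..int n}"
      show "k \<in> ?w ` {- int n..int n}"
      proof (rule image_eqI)
        show "k = ?w (?w k)" using k by (auto simp: signed_transposition_invol fsb_id_def)
        show "?w k \<in> {- int n..int n}" using k sub by blast
      qed
    qed
  qed (rule sub)
qed (auto simp: signed_transposition_def)

lemma fsb_inv_signed_transposition:
  "fsb_inv n (signed_transposition n p q \<epsilon>) = signed_transposition n p q \<epsilon>"
proof
  let ?w = "signed_transposition n p q \<epsilon>"
  fix k
  have inj: "inj_on ?w {- int n..int n}"
  proof (rule inj_on_inverseI)
    show "?w (?w k) = k" if "k \<in> {- int n..int n}" for k
      using that by (auto simp: signed_transposition_invol fsb_id_def)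
  qed
  show "fsb_inv n ?w k = ?w k"
  proof (cases "\<bar>k\<bar> \<le> int n")
    case True
    have "the_inv_into {- int n..int n} ?w (?w (?w k)) = ?w k"
    proof (rule the_inv_into_f_f[OF inj])
      show "?w k \<in> {- int n..int n}"
        using fsb_hom_abs_le[OF fsb_hom_signed_transposition, of k] by (simp add: abs_le_iff)
    qed
    then show ?thesis using True by (simp add: fsb_inv_def signed_transposition_invol fsb_id_def)
  qed (simp add: fsb_inv_def signed_transposition_def)
qed

lemma wperm_signed_transposition:
  "wperm n (signed_transposition n p q \<epsilon>) = transpose p q"
  using pq \<epsilon> by (auto simp: wperm_def signed_transposition_def transpose_def fun_eq_iff abs_mult)

lemma wsign_signed_transposition:
  "i \<in> {1..n} \<Longrightarrow> wsign (signed_transposition n p q \<epsilon>) i = (if i = p \<or> i = q then of_int \<epsilon> else 1)"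
  using pq \<epsilon> by (auto simp: wsign_def signed_transposition_def)

text \<open>The condition is symmetric in \<open>p\<close> and \<open>q\<close> because
  \<open>\<epsilon>\<close> squares to 1. For \<open>p = q\<close> and
  \<open>\<epsilon> = - 1\<close> it says that \<open>u\<close> vanishes at
  \<open>p\<close>.\<close>

lemma comp_signed_transposition:
  assumes "fsb_hom n m u" "u (int p) = \<epsilon> * u (int q)"
  shows "u \<circ> signed_transposition n p q \<epsilon> = u"
proof
  fix k
  have odd: "u (- k) = - u k" for k using assms(1) by (simp add: fsb_hom_def)
  have pm: "u (\<epsilon> * j) = \<epsilon> * u j" for j using \<epsilon> odd by auto
  have q: "u (int q) = \<epsilon> * u (int p)" using assms(2) \<epsilon> by auto
  consider "\<bar>k\<bar> > int n" | "\<bar>k\<bar> \<le> int n" "k = int p \<or> k = - int p"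
    | "\<bar>k\<bar> \<le> int n" "\<bar>k\<bar> \<noteq> int p" "k = int q \<or> k = - int q"
    | "\<bar>k\<bar> \<le> int n" "\<bar>k\<bar> \<noteq> int p" "\<bar>k\<bar> \<noteq> int q" by linarith
  then show "(u \<circ> signed_transposition n p q \<epsilon>) k = u k"
  proof cases
    case 1
    then show ?thesis
      using assms(1) fsb_hom_zero[OF assms(1)] by (simp add: signed_transposition_def fsb_hom_def)
  next
    case 2
    then show ?thesis using pq pm[of "int q"] pm[of "- int q"] odd assms(2)
      by (auto simp: signed_transposition_def)
  next
    case 3
    then show ?thesis using pq pm[of "int p"] pm[of "- int p"] odd q
      by (auto simp: signed_transposition_def)
  next
    case 4
    then show ?thesis by (simp add: signed_transposition_def)
  qed
qed

end

text \<open>The transposition already gives the sign -1. The remaining product is 1: it is free of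
  \<open>\<epsilon>\<close> if the column lies in \<open>la\<close>, and contains
  \<open>\<epsilon>\<close> exactly twice if it lies in \<open>mu\<close>.\<close>

lemma bitab_act_signed_transposition:
  assumes T: "bij_betw T (bicells la mu) {1..n}"
    and ab: "a \<in> bicells la mu" "b \<in> bicells la mu" "a \<noteq> b" "fst a = fst b" "snd (snd a) = snd (snd b)"
    and \<epsilon>: "\<epsilon> = 1 \<or> \<epsilon> = - 1"
  shows "bitab_act n (signed_transposition n (T a) (T b) \<epsilon>) (bipolytabloid n la mu T) =
    - (bipolytabloid n la mu T :: _ \<Rightarrow> 'k::field)"
proof
  fix r :: "nat \<Rightarrow> (bool \<times> nat) option"
  let ?e = "bipolytabloid n la mu T :: _ \<Rightarrow> 'k"
  have pq: "T a \<in> {1..n}" "T b \<in> {1..n}" using T ab by (auto simp: bij_betw_def)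
  have "T a \<noteq> T b" using T ab by (auto simp: bij_betw_def inj_on_def)
  define I where "I = {i \<in> {1..n}. \<exists>j. r (transpose (T a) (T b) i) = Some (False, j)}"
  have act: "bitab_act n (signed_transposition n (T a) (T b) \<epsilon>) ?e r =
      (\<Prod>i\<in>I. if i = T a \<or> i = T b then of_int \<epsilon> else 1) * - ?e r"
    unfolding bitab_act_def wperm_signed_transposition[OF pq \<epsilon>] bipolytabloid_transpose[OF T ab] I_def
    by (intro arg_cong2[where f = times] prod.cong refl) (simp add: wsign_signed_transposition[OF pq \<epsilon>])
  show "bitab_act n (signed_transposition n (T a) (T b) \<epsilon>) ?e r = (- ?e) r"
  proof (cases "?e r = 0")
    case True
    then show ?thesis using act by simp
  next
    case False
    obtain j j' where r: "r (T a) = Some (fst a, j)" "r (T b) = Some (fst a, j')"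
      using bipolytabloid_support[OF T False ab(1)] bipolytabloid_support[OF T False ab(2)] ab(4)
      by auto
    have "(\<Prod>i\<in>I. if i = T a \<or> i = T b then of_int \<epsilon> else 1) = (1 :: 'k)"
    proof (cases "fst a")
      case True
      then have "T a \<notin> I" "T b \<notin> I" using r by (auto simp: I_def)
      then show ?thesis by (intro prod.neutral) auto
    next
      case False
      then have "{T a, T b} \<subseteq> I" using r pq by (auto simp: I_def)
      then have "(\<Prod>i\<in>I. if i = T a \<or> i = T b then of_int \<epsilon> else 1) =
          (\<Prod>i\<in>{T a, T b}. if i = T a \<or> i = T b then of_int \<epsilon> else (1 :: 'k))"
        by (intro prod.mono_neutral_right) (auto simp: I_def)
      also have "\<dots> = 1" using \<open>T a \<noteq> T b\<close> \<epsilon> by auto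
      finally show ?thesis .
    qed
    then show ?thesis using act by simp
  qed
qed

text \<open>The underlying permutation is the identity, and the label \<open>T a\<close> contributes
  the only factor -1, as it always stays in the \<open>mu\<close> part.\<close>

lemma bitab_act_negation:
  assumes T: "bij_betw T (bicells la mu) {1..n}" and a: "a \<in> bicells la mu" "\<not> fst a"
  shows "bitab_act n (signed_transposition n (T a) (T a) (- 1)) (bipolytabloid n la mu T) =
    - (bipolytabloid n la mu T :: _ \<Rightarrow> 'k::field)"
proof
  fix r :: "nat \<Rightarrow> (bool \<times> nat) option"
  let ?e = "bipolytabloid n la mu T :: _ \<Rightarrow> 'k"
  have p: "T a \<in> {1..n}" using T a by (auto simp: bij_betw_def)
  have \<epsilon>: "- 1 = (1 :: int) \<or> - 1 = (- 1 :: int)" by simp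
  define I where "I = {i \<in> {1..n}. \<exists>j. r i = Some (False, j)}"
  have act: "bitab_act n (signed_transposition n (T a) (T a) (- 1)) ?e r =
      (\<Prod>i\<in>I. if i = T a then - 1 else 1) * ?e r"
    unfolding bitab_act_def wperm_signed_transposition[OF p p \<epsilon>] I_def
    by (intro arg_cong2[where f = times] prod.cong)
      (auto simp: wsign_signed_transposition[OF p p \<epsilon>] comp_def)
  show "bitab_act n (signed_transposition n (T a) (T a) (- 1)) ?e r = (- ?e) r"
  proof (cases "?e r = 0")
    case True
    then show ?thesis using act by simp
  next
    case False
    then have "T a \<in> I" using bipolytabloid_support[OF T False a(1)] a(2) p by (auto simp: I_def)
    then show ?thesis using act by (simp add: I_def prod.delta)
  qed
qed

section \<open>Multiplicities\<close>

text \<open>The group \<open>H\<close> of all \<open>w\<close> with \<open>w y = \<plusminus> y\<close> acts on \<open>y\<close> by a character \<open>\<chi>\<close>, and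
  \<open>\<Sum>w\<in>H. \<chi> w \<cdot> w\<close> kills every basis vector \<open>u\<close> that is fixed by some \<open>w\<close> with \<open>\<chi> w = - 1\<close>.\<close>

lemma fsb_relation_antisymmetric:
  fixes scale :: "'k::field_char_0 \<Rightarrow> 'v::ab_group_add \<Rightarrow> 'v"
  assumes G: "fsb_relation ms scale act G" and N: "fsb_module scale C act"
    and xy: "(x, y) \<in> G n" and y: "y \<in> C n"
    and fixed: "\<And>i u. i < length ms \<Longrightarrow> fsb_hom n (ms ! i) u \<Longrightarrow>
      \<exists>w. fsb_hom n n w \<and> act n n w y = - y \<and> w \<circ> w = fsb_id n \<and> u \<circ> w = u"
  shows "(0, y) \<in> G n"
proof (cases "y = 0")
  case True
  then show ?thesis using fsb_relationD(2)[OF G] by simp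
next
  case False
  interpret vector_space scale using N by (simp add: fsb_module_def)
  \<comment> \<open>Characteristic zero separates the two cases in \<open>H\<close>, so
    \<open>\<chi>\<close> really records the sign.\<close>
  have "y \<noteq> - y"
  proof
    assume "y = - y"
    then have "y + y = 0" by (metis add.right_inverse)
    then have "scale 2 y = 0" using scale_left_distrib[of 1 1 y] by simp
    then show False using False by simp
  qed
  define H where "H = {w. fsb_hom n n w \<and> (act n n w y = y \<or> act n n w y = - y)}"
  define \<chi> :: "(int \<Rightarrow> int) \<Rightarrow> 'k" where "\<chi> w = (if act n n w y = y then 1 else - 1)" for w
  have "finite H" by (rule finite_subset[OF _ finite_fsb_hom[of n n]]) (auto simp: H_def)
  have "fsb_id n \<in> H"
  proof -
    have "(\<lambda>k. fsb_id n k) ` {- int n..int n} = {- int n..int n}"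
      by (force simp: fsb_id_def)
    then have "fsb_hom n n (fsb_id n)" by (auto simp: fsb_hom_def fsb_id_def)
    moreover have "act n n (fsb_id n) y = y" using N y unfolding fsb_module_def by blast
    ultimately show ?thesis by (simp add: H_def)
  qed
  then have card: "of_nat (card H) \<noteq> (0 :: 'k)" using \<open>finite H\<close> by auto
  have act_minus: "act n n w (- y) = - act n n w y" if "fsb_hom n n w" for w
  proof -
    have "act n n w (scale (- 1) y) = scale (- 1) (act n n w y)"
      using N that y unfolding fsb_module_def by blast
    then show ?thesis by simp
  qed
  \<comment> \<open>By contravariance \<open>w0 \<circ> w\<close> acts by \<open>w0\<close> first
    and then by \<open>w\<close>, so composing with \<open>w0\<close> on the left flips
    \<open>\<chi>\<close>.\<close>
  have comp: "w0 \<circ> w \<in> H \<and> \<chi> (w0 \<circ> w) = - \<chi> w"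
    if "fsb_hom n n w0" "act n n w0 y = - y" "w \<in> H" for w0 w
  proof -
    have w: "fsb_hom n n w" using that(3) by (simp add: H_def)
    have "act n n (w0 \<circ> w) y = act n n w (act n n w0 y)"
      using N w that(1) y unfolding fsb_module_def by blast
    then have "act n n (w0 \<circ> w) y = - act n n w y" using that(2) act_minus[OF w] by simp
    then show ?thesis
      using that(3) fsb_hom_comp[OF w that(1)] \<open>y \<noteq> - y\<close> by (auto simp: H_def \<chi>_def)
  qed
  \<comment> \<open>The antisymmetrizer applied to \<open>x\<close>. The same combination takes
    \<open>y\<close> to \<open>card H\<close> times \<open>y\<close>, because
    \<open>\<chi> w\<close> undoes the sign of \<open>w\<close>.\<close>
  define x' where "x' = (\<Sum>w\<in>H. pscale (\<chi> w) (projsum_act ms n n w x))"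
  have sum_G: "((\<Sum>w\<in>K. pscale (\<chi> w) (projsum_act ms n n w x)),
      (\<Sum>w\<in>K. scale (\<chi> w) (act n n w y))) \<in> G n" if "finite K" "K \<subseteq> H" for K
    using that
  proof (induction K rule: finite_induct)
    case empty
    show ?case using fsb_relationD(2)[OF G] by (simp only: sum.empty)
  next
    case (insert w K)
    have "fsb_hom n n w" using insert.prems by (auto simp: H_def)
    then have "(pscale (\<chi> w) (projsum_act ms n n w x), scale (\<chi> w) (act n n w y)) \<in> G n"
      by (intro fsb_relationD(4)[OF G] fsb_relationD(5)[OF G] xy)
    moreover have "((\<Sum>w\<in>K. pscale (\<chi> w) (projsum_act ms n n w x)),
      (\<Sum>w\<in>K. scale (\<chi> w) (act n n w y))) \<in> G n" using insert by simp
    ultimately show ?case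
      unfolding sum.insert[OF insert.hyps] by (rule fsb_relationD(3)[OF G])
  qed
  have "(\<Sum>w\<in>H. scale (\<chi> w) (act n n w y)) = (\<Sum>w\<in>H. y)"
    by (rule sum.cong) (auto simp: H_def \<chi>_def)
  also have "\<dots> = scale (of_nat (card H)) y" by (simp add: sum_constant_scale)
  finally have x'G: "(x', scale (of_nat (card H)) y) \<in> G n"
    using sum_G[OF \<open>finite H\<close> subset_refl] by (simp add: x'_def)
  have carrier: "x \<in> projsum_carrier ms n" using fsb_relationD(1)[OF G xy] .
  have "x' (i, v) = 0" for i v
  proof -
    define U where "U = {u. fsb_hom n (ms ! i) u}"
    have "finite U" by (simp add: U_def finite_fsb_hom)
    have "x' (i, v) = (\<Sum>w\<in>H. \<chi> w * (\<Sum>u \<in> {u \<in> U. u \<circ> w = v}. x (i, u)))"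
    proof -
      have "(\<Sum>w\<in>K. pscale (\<chi> w) (projsum_act ms n n w x)) (i, v) =
          (\<Sum>w\<in>K. \<chi> w * (\<Sum>u \<in> {u \<in> U. u \<circ> w = v}. x (i, u)))" for K
        by (induction K rule: infinite_finite_induct)
          (simp_all add: pscale_def projsum_act_def U_def comp_def)
      then show ?thesis by (simp add: x'_def)
    qed
    also have "\<dots> = (\<Sum>w\<in>H. \<Sum>u\<in>U. if u \<circ> w = v then \<chi> w * x (i, u) else 0)"
      using \<open>finite U\<close> by (auto simp: sum_distrib_left sum.inter_filter intro!: sum.cong)
    also have "\<dots> = (\<Sum>u\<in>U. \<Sum>w\<in>H. if u \<circ> w = v then \<chi> w * x (i, u) else 0)"
      by (rule sum.swap)
    also have "\<dots> = (\<Sum>u\<in>U. (\<Sum>w\<in>{w \<in> H. u \<circ> w = v}. \<chi> w) * x (i, u))"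
      using \<open>finite H\<close> by (auto simp: sum_distrib_right sum.inter_filter intro!: sum.cong)
    also have "\<dots> = 0"
    proof (rule sum.neutral, rule ballI)
      fix u assume u: "u \<in> U"
      show "(\<Sum>w\<in>{w \<in> H. u \<circ> w = v}. \<chi> w) * x (i, u) = 0"
      proof (cases "i < length ms")
        case False
        then show ?thesis using carrier by (auto simp: projsum_carrier_def)
      next
        case True
        then obtain w0 where w0: "fsb_hom n n w0" "act n n w0 y = - y" "w0 \<circ> w0 = fsb_id n"
            "u \<circ> w0 = u"
          using fixed u by (auto simp: U_def)
        have w0w0: "w0 \<circ> (w0 \<circ> w) = w" if "w \<in> H" for w
        proof
          fix k
          have "\<bar>w k\<bar> \<le> int n" using that fsb_hom_abs_le by (auto simp: H_def)
          then show "(w0 \<circ> (w0 \<circ> w)) k = w k"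
            using fun_cong[OF w0(3), of "w k"] by (simp add: fsb_id_def)
        qed
        have u_comp: "u \<circ> (w0 \<circ> w) = u \<circ> w" for w
          by (metis comp_assoc w0(4))
        \<comment> \<open>Since \<open>u \<circ> w0 = u\<close>, the involution
          \<open>w \<mapsto> w0 \<circ> w\<close> preserves the index set while reversing
          \<open>\<chi>\<close>: the sum equals its negative.\<close>
        have "(\<Sum>w\<in>{w \<in> H. u \<circ> w = v}. \<chi> w) = (\<Sum>w\<in>{w \<in> H. u \<circ> w = v}. - \<chi> w)"
          by (rule sum.reindex_bij_witness[where i = "\<lambda>w. w0 \<circ> w" and j = "\<lambda>w. w0 \<circ> w"])
            (simp_all add: comp[OF w0(1,2)] w0w0 u_comp del: comp_apply)
        then have "(\<Sum>w\<in>{w \<in> H. u \<circ> w = v}. \<chi> w) = 0"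
          by (simp add: sum_negf)
        then show ?thesis by simp
      qed
    qed
    finally show ?thesis .
  qed
  then have "x' = 0" by (auto simp: fun_eq_iff)
  then have "(pscale (1 / of_nat (card H)) 0, scale (1 / of_nat (card H)) (scale (of_nat (card H)) y)) \<in> G n"
    using x'G by (intro fsb_relationD(4)[OF G]) simp
  moreover have "pscale (1 / of_nat (card H) :: 'k) 0 = 0" by (simp add: pscale_def zero_fun_def)
  ultimately show ?thesis using card by simp
qed

lemma module_fscale: "module fscale"
  by standard (auto simp: fscale_def algebra_simps)

text \<open>A nonzero image \<open>y\<close> of a polytabloid survives in some layer of the
  filtration, which forces a basis map \<open>u\<close> fixed by none of the reflections negating
  \<open>y\<close>. Then \<open>\<bar>u\<bar>\<close> is injective on the labels of each first
  column.\<close>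

lemma hom_Wn_nonzero_bounds:
  fixes scale :: "'k::field_char_0 \<Rightarrow> 'v::ab_group_add \<Rightarrow> 'v"
  assumes N: "fsb_module scale C act" and small: "d_smallish d scale C act"
    and part: "is_partition la" "is_partition mu" and hom: "hom_Wn_nonzero scale C act la mu"
  shows "length la \<le> d + 1 \<and> length mu \<le> d"
proof -
  interpret vector_space scale using N by (simp add: fsb_module_def)
  define n where "n = sum_list la + sum_list mu"
  define P :: "((nat \<Rightarrow> (bool \<times> nat) option) \<Rightarrow> 'k) set"
    where "P = {bipolytabloid n la mu T | T. bitableau n la mu T}"
  define V where "V = module.span fscale P"
  have V: "V_B la mu = V" by (simp add: V_B_def V_def P_def n_def Let_def)
  obtain h where h: "\<And>v. v \<in> V \<Longrightarrow> h v \<in> C n"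
    "\<And>v v'. v \<in> V \<Longrightarrow> v' \<in> V \<Longrightarrow> h (v + v') = h v + h v'"
    "\<And>c v. v \<in> V \<Longrightarrow> h (fscale c v) = scale c (h v)"
    "\<And>w v. fsb_hom n n w \<Longrightarrow> v \<in> V \<Longrightarrow> h (bitab_act n w v) = act n n (fsb_inv n w) (h v)"
    "\<exists>v\<in>V. h v \<noteq> 0"
    using hom unfolding hom_Wn_nonzero_def V n_def[symmetric] Let_def by blast
  note V_span = module.span_zero[OF module_fscale, of P, folded V_def]
    module.span_add[OF module_fscale, of _ P, folded V_def]
    module.span_scale[OF module_fscale, of _ P, folded V_def]
    module.span_base[OF module_fscale, of _ P, folded V_def]
  have h0: "h 0 = 0"
  proof -
    have "fscale 0 (0 :: (nat \<Rightarrow> (bool \<times> nat) option) \<Rightarrow> 'k) = 0" by (auto simp: fscale_def)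
    then show ?thesis using h(3)[OF V_span(1), of 0] by simp
  qed
  have "\<exists>e\<in>P. h e \<noteq> 0"
  proof (rule ccontr)
    assume zero: "\<not> (\<exists>e\<in>P. h e \<noteq> 0)"
    have "v \<in> V \<and> h v = 0" if "v \<in> module.span fscale P" for v
      using that
    proof (rule module.span_induct[OF module_fscale])
      show "module.subspace fscale {v. v \<in> V \<and> h v = 0}"
        unfolding module.subspace_def[OF module_fscale] using V_span h h0 by auto
    qed (use zero V_span(4) in auto)
    then show False using h(5) by (auto simp: V_def)
  qed
  then obtain T where tab: "bitableau n la mu T"
    and ne: "h (bipolytabloid n la mu T) \<noteq> 0" by (auto simp: P_def)
  have T: "bij_betw T (bicells la mu) {1..n}" using tab by (simp add: bitableau_def)
  define e where "e = (bipolytabloid n la mu T :: _ \<Rightarrow> 'k)"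
  have eV: "e \<in> V" using tab by (intro V_span(4)) (auto simp: P_def e_def)
  define y where "y = h e"
  have y: "y \<noteq> 0" "y \<in> C n" using ne h(1)[OF eV] by (simp_all add: y_def e_def)
  have antisym: "act n n (fsb_inv n w) y = - y" if "fsb_hom n n w" "bitab_act n w e = - e" for w
  proof -
    have "- e = fscale (- 1) e" by (auto simp: fscale_def)
    then have "h (- e) = - y" using h(3)[OF eV, of "- 1"] by (simp add: y_def)
    then show ?thesis using h(4)[OF that(1) eV] that(2) by (simp add: y_def)
  qed
  obtain ms F r G where filtration: "\<forall>m\<in>set ms. m \<le> d" "F 0 = (\<lambda>n. {0})" "F r = C"
      "\<forall>i. fsb_submodule scale C act (F i)"
      "\<forall>i<r. fsb_relation ms scale act (G i)"
      "\<forall>i<r. \<forall>n. snd ` G i n = F (Suc i) n"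
      "\<forall>i<r. \<forall>n. {y. (0, y) \<in> G i n} = F i n"
    by (rule d_smallish_filtration[OF N small])
  \<comment> \<open>The least \<open>k\<close> with \<open>y\<close> in \<open>F k n\<close> locates
    the layer in which \<open>y\<close> is nonzero; it is positive because \<open>F 0\<close> is
    zero.\<close>
  obtain k where k: "k \<le> r" "y \<in> F k n" "\<forall>i<k. y \<notin> F i n"
    using ex_least_nat_le[of "\<lambda>k. y \<in> F k n" r] y(2) filtration(3) by auto
  have "k \<noteq> 0" using k(2) y(1) filtration(2) by (cases k) auto
  then obtain i where i: "k = Suc i" by (cases k) auto
  then have "i < r" using k(1) by simp
  then have "y \<in> snd ` G i n" using filtration(6) k(2) i by simp
  then obtain x where x: "(x, y) \<in> G i n" by auto
  have "(0, y) \<notin> G i n" using filtration(7) k(3) i \<open>i < r\<close> by auto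
  \<comment> \<open>The contrapositive of \<open>fsb_relation_antisymmetric\<close>: a basis map
    fixed by no involution that negates \<open>y\<close>.\<close>
  then obtain j u where j: "j < length ms" and u: "fsb_hom n (ms ! j) u"
    and nofix: "\<And>w. fsb_hom n n w \<Longrightarrow> act n n w y = - y \<Longrightarrow> w \<circ> w = fsb_id n \<Longrightarrow> u \<circ> w \<noteq> u"
    using fsb_relation_antisymmetric[OF filtration(5)[rule_format, OF \<open>i < r\<close>] N x y(2)] by blast
  define m where "m = ms ! j"
  have "m \<le> d" using filtration(1) j by (simp add: m_def)
  have u_le: "nat \<bar>u l\<bar> \<le> d" for l
    using fsb_hom_abs_le[OF u[folded m_def], of l] \<open>m \<le> d\<close> by linarith
  have range: "T a \<in> {1..n}" if "a \<in> bicells la mu" for a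
    using T that by (auto simp: bij_betw_def)
  have distinct: "\<bar>u (int (T a))\<bar> \<noteq> \<bar>u (int (T b))\<bar>"
    if ab: "a \<in> bicells la mu" "b \<in> bicells la mu" "a \<noteq> b" "fst a = fst b" "snd (snd a) = snd (snd b)"
    for a b
  proof
    assume "\<bar>u (int (T a))\<bar> = \<bar>u (int (T b))\<bar>"
    then obtain \<epsilon> :: int where \<epsilon>: "\<epsilon> = 1 \<or> \<epsilon> = - 1" "u (int (T a)) = \<epsilon> * u (int (T b))"
      by (metis abs_eq_iff mult_1 mult_minus1)
    let ?w = "signed_transposition n (T a) (T b) \<epsilon>"
    note w = range[OF ab(1)] range[OF ab(2)] \<epsilon>(1)
    show False
    proof (rule nofix[of ?w, THEN notE])
      show "act n n ?w y = - y"
        using antisym[OF fsb_hom_signed_transposition[OF w]] bitab_act_signed_transposition[OF T ab \<epsilon>(1)]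
        by (simp add: e_def fsb_inv_signed_transposition[OF w])
      show "u \<circ> ?w = u" using comp_signed_transposition[OF w u \<epsilon>(2)] .
    qed (auto simp: fsb_hom_signed_transposition[OF w] signed_transposition_invol[OF w])
  qed
  have nonzero: "u (int (T a)) \<noteq> 0" if a: "a \<in> bicells la mu" "\<not> fst a" for a
  proof
    assume u0: "u (int (T a)) = 0"
    let ?w = "signed_transposition n (T a) (T a) (- 1)"
    have "- 1 = (1 :: int) \<or> - 1 = (- 1 :: int)" by simp
    note w = range[OF a(1)] range[OF a(1)] this
    show False
    proof (rule nofix[of ?w, THEN notE])
      show "act n n ?w y = - y"
        using antisym[OF fsb_hom_signed_transposition[OF w]] bitab_act_negation[OF T a]
        by (simp add: e_def fsb_inv_signed_transposition[OF w])
      show "u \<circ> ?w = u" using comp_signed_transposition[OF w u] u0 by simp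
    qed (auto simp: fsb_hom_signed_transposition[OF w] signed_transposition_invol[OF w])
  qed
  have la_cell: "(True, k, 0) \<in> bicells la mu" if "k < length la" for k
    using that part(1) by (auto simp: bicells_def is_partition_def)
  have mu_cell: "(False, k, 0) \<in> bicells la mu" if "k < length mu" for k
    using that part(2) by (auto simp: bicells_def is_partition_def)
  \<comment> \<open>The first column of \<open>la\<close> takes distinct values in 0, ..., d. For
    \<open>mu\<close> the value 0 is excluded by \<open>nonzero\<close>, which lowers the bound by
    one.\<close>
  have "card {..<length la} \<le> card {..d}"
  proof (rule card_inj_on_le)
    show "inj_on (\<lambda>k. nat \<bar>u (int (T (True, k, 0)))\<bar>) {..<length la}"
    proof (rule inj_onI, rule ccontr)
      fix k l assume "k \<in> {..<length la}" "l \<in> {..<length la}" "k \<noteq> l"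
        "nat \<bar>u (int (T (True, k, 0)))\<bar> = nat \<bar>u (int (T (True, l, 0)))\<bar>"
      then show False using distinct[of "(True, k, 0)" "(True, l, 0)"] la_cell by simp
    qed
  qed (use u_le in auto)
  moreover have "card {..<length mu} \<le> card {1..d}"
  proof (rule card_inj_on_le)
    show "inj_on (\<lambda>k. nat \<bar>u (int (T (False, k, 0)))\<bar>) {..<length mu}"
    proof (rule inj_onI, rule ccontr)
      fix k l assume "k \<in> {..<length mu}" "l \<in> {..<length mu}" "k \<noteq> l"
        "nat \<bar>u (int (T (False, k, 0)))\<bar> = nat \<bar>u (int (T (False, l, 0)))\<bar>"
      then show False using distinct[of "(False, k, 0)" "(False, l, 0)"] mu_cell by simp
    qed
    show "(\<lambda>k. nat \<bar>u (int (T (False, k, 0)))\<bar>) ` {..<length mu} \<subseteq> {1..d}"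
      using u_le nonzero mu_cell by (force simp: Suc_le_eq)
  qed simp
  ultimately show ?thesis by simp
qed

theorem mainTheorem2:
  fixes scale :: "'k::field_char_0 \<Rightarrow> 'v::ab_group_add \<Rightarrow> 'v"
    and C :: "nat \<Rightarrow> 'v set"
    and act :: "nat \<Rightarrow> nat \<Rightarrow> (int \<Rightarrow> int) \<Rightarrow> 'v \<Rightarrow> 'v"
    and d :: nat
  assumes "fsb_module scale C act"
    and "d_smallish d scale C act"
  shows
    "(\<exists>P Q :: complex poly. Q \<noteq> 0 \<and>
        (\<forall>z. poly Q z = 0 \<longrightarrow> z \<in> {1 / of_nat j | j. 1 \<le> j \<and> j \<le> 2 * d + 1}) \<and>
        fps_of_poly P = hilb_B scale C * fps_of_poly Q)
   \<and> convergent (\<lambda>n. real (fsb_dim scale C n) / real (2 * d + 1) ^ n)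
   \<and> (\<exists>P Q :: complex poly. Q \<noteq> 0 \<and>
        (\<forall>z. poly Q z = 0 \<longrightarrow> z \<in> {1 / of_nat j | j. 1 \<le> j \<and> j \<le> 2 * d + 1}) \<and>
        order (1 / of_nat (2 * d + 1)) Q \<le> 1 \<and>
        fps_of_poly P = hilb_B scale C * fps_of_poly Q)
   \<and> (\<forall>la mu. is_partition la \<longrightarrow> is_partition mu \<longrightarrow>
        hom_Wn_nonzero scale C act la mu \<longrightarrow>
        length la \<le> d + 1 \<and> length mu \<le> d)"
proof -
  let ?M = "2 * d + 1"
  have simple: "simple_at ?M (hilb_B scale C)"
    using assms by (rule simple_at_hilb_B)
  \<comment> \<open>A single denominator serves both the location of the poles and the simplicity of
    the pole at 1/(2d+1).\<close>
  then have rational: "\<exists>P Q :: complex poly. Q \<noteq> 0 \<and>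
        (\<forall>z. poly Q z = 0 \<longrightarrow> z \<in> {1 / of_nat j | j. 1 \<le> j \<and> j \<le> ?M}) \<and>
        order (1 / of_nat ?M) Q \<le> 1 \<and> fps_of_poly P = hilb_B scale C * fps_of_poly Q"
    by (rule simple_at_rational) simp
  have "convergent (\<lambda>n. hilb_B scale C $ n / of_nat ?M ^ n)"
    using simple by (simp only: simple_at_def)
  then obtain L where "(\<lambda>n. hilb_B scale C $ n / of_nat ?M ^ n) \<longlonglongrightarrow> L"
    by (auto simp only: convergent_def)
  \<comment> \<open>The coefficients of \<open>hilb_B\<close> are natural numbers viewed as complex
    ones, so taking real parts transfers the convergence to the reals.\<close>
  from tendsto_Re[OF this]
  have "(\<lambda>n. real (fsb_dim scale C n) / real ?M ^ n) \<longlonglongrightarrow> Re L"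
  proof (rule Lim_transform_eventually)
    have "Re (hilb_B scale C $ n / of_nat ?M ^ n) = real (fsb_dim scale C n) / real ?M ^ n" for n
    proof -
      have "hilb_B scale C $ n / of_nat ?M ^ n =
          complex_of_real (real (fsb_dim scale C n) / real ?M ^ n)"
        by (simp add: hilb_B_def)
      then show ?thesis by (simp only: Re_complex_of_real)
    qed
    then show "\<forall>\<^sub>F n in sequentially. Re (hilb_B scale C $ n / of_nat ?M ^ n) =
        real (fsb_dim scale C n) / real ?M ^ n" by (rule always_eventually[OF allI])
  qed
  then have "convergent (\<lambda>n. real (fsb_dim scale C n) / real ?M ^ n)" by (rule convergentI)
  moreover have "\<exists>P Q :: complex poly. Q \<noteq> 0 \<and>
        (\<forall>z. poly Q z = 0 \<longrightarrow> z \<in> {1 / of_nat j | j. 1 \<le> j \<and> j \<le> ?M}) \<and>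
        fps_of_poly P = hilb_B scale C * fps_of_poly Q"
    using rational by blast
  moreover have "\<forall>la mu. is_partition la \<longrightarrow> is_partition mu \<longrightarrow>
      hom_Wn_nonzero scale C act la mu \<longrightarrow> length la \<le> d + 1 \<and> length mu \<le> d"
    using hom_Wn_nonzero_bounds[OF assms] by blast
  ultimately show ?thesis using rational by (intro conjI)
qed

end
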